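(* Let $k \geq 2$ be an integer and let $(F_m)_{m\geq 1}$ be a F{\o}lner sequence in $(\mathbf{N},\cdot)$. Then $F_m$ has no $k$-sum-free subset of size greater than $\left(\frac{1}{k+1}+o(1)\right)|F_m|$ as $m\to\infty$. That is, for every $\eta>0$ there is $M$ such that for all $m\geq M$, every $k$-sum-free subset $S\subset F_m$ satisfies $|S|\leq \left(\frac{1}{k+1}+\eta\right)|F_m|$.
   Context: $\mathbf{N}$ denotes the set of positive integers. A subset $A$ of an abelian group is called $k$-sum-free if there do not exist (not necessarily distinct) $a_1,\dots,a_k\in A$ such that $a_1+\cdots+a_k\in A$; subsets of $\mathbf{N}$ are regarded as subsets of $\mathbf{Z}$. A sequence $(F_m)$ of finite nonempty subsets $F_m\subset\mathbf{N}$ is a F{\o}lner sequence in $(\mathbf{N},\cdot)$ if for every fixed $a\in\mathbf{N}$ one has $\frac{|(a\cdot F_m)\triangle F_m|}{|F_m|}\to 0$ as $m\to\infty$, where $a\cdot F_m=\{ax : x\in F_m\}$ and $\triangle$ denotes symmetric difference. *)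

theory Defs
  imports Complex_Main
begin

text \<open>The summands are indexed by \<open>i < k\<close>, and repetitions are allowed.\<close>

definition k_sum_free :: "nat \<Rightarrow> 'a::ab_group_add set \<Rightarrow> bool" where
  "k_sum_free k A \<longleftrightarrow> \<not> (\<exists>a :: nat \<Rightarrow> 'a. (\<forall>i<k. a i \<in> A) \<and> (\<Sum>i<k. a i) \<in> A)"

text \<open>The type \<open>nat\<close> contains \<open>0\<close>, so positivity of the elements and of the dilation factor
  is explicit. Sequences are indexed by \<open>m \<ge> 1\<close>; the value \<open>F 0\<close> is unconstrained.\<close>

definition mult_folner_seq :: "(nat \<Rightarrow> nat set) \<Rightarrow> bool" where
  "mult_folner_seq F \<longleftrightarrow>
     (\<forall>m\<ge>1. finite (F m) \<and> F m \<noteq> {} \<and> F m \<subseteq> {0<..}) \<and>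
     (\<forall>a\<ge>1. (\<lambda>m. real (card (sym_diff ((\<lambda>x. a * x) ` F m) (F m))) / real (card (F m)))
               \<longlonglongrightarrow> 0)"

end

theory Submission
  imports Defs "HOL-Analysis.Function_Topology" "HOL-Analysis.Uniform_Limit"
begin

text \<open>Suppose that for some \<open>\<delta> > 1/(k+1)\<close> there are sets \<open>F\<close> arbitrarily far along the multiplicative Folner
sequence with \<open>k\<close>-sum-free subsets \<open>S\<close> of density at least \<open>\<delta>\<close>. For a random \<open>x\<close> in \<open>F\<close> the set of
rationals \<open>{q > 0. q x \<in> S}\<close> is again \<open>k\<close>-sum-free, and since \<open>F\<close> is almost invariant under dilations,
it contains each given \<open>q > 0\<close> with probability at least \<open>\<delta> - o(1)\<close>. Averaged over \<open>x\<close>, it therefore has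
density at least \<open>\<delta> - o(1)\<close> in every finite additive window of rationals. A Fatou argument for finitely additive
probabilities (\<open>ex_hitting_blocks\<close>) and a limit of sets (\<open>ex_limit_set\<close>) turn this into a single
\<open>k\<close>-sum-free set of rationals which is dense in infinitely many windows. Averaging over these windows
gives a translation-invariant mean on the rationals for which this set has mass above \<open>1/(k+1)\<close>.

This contradicts \<open>mass_k_sum_free_le\<close>: a \<open>k\<close>-sum-free set \<open>A\<close> of rationals has mass at most \<open>1/(k+1)\<close> for
every translation-invariant mean. The passage from integers to rationals is what makes the bound true: the odd
numbers have density \<open>1/2\<close> and are sum-free, but the group of rationals is divisible, so it has no
proper subgroups of finite index that could make sumsets small. If the mass of \<open>A\<close> exceeds
\<open>1/(k+1)\<close> for some mean, then it does so for an ergodic one, and for ergodic means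
the mass of \<open>A + B\<close> is at least the minimum of \<open>1\<close> and the sum of the two masses (\<open>mass_sumset_ge\<close>). Hence
the \<open>k\<close>-fold sumset of \<open>A\<close> has mass at least \<open>k\<close> times that of \<open>A\<close>, or mass \<open>1\<close>; as it is disjoint from
\<open>A\<close>, both are impossible.

The sumset inequality is proved with the transform replacing \<open>(A, B)\<close> by
\<open>(A \<union> (B + x), B \<inter> (A - x))\<close>, which preserves the total mass and does not enlarge the sumset. When the mass of
\<open>B\<close> cannot be lowered any further, every translate of \<open>B\<close> that meets \<open>A\<close> lies almost entirely in \<open>A\<close>. By
ergodicity \<open>A\<close> is then almost invariant under all differences of elements of \<open>B\<close>, hence, by
pigeonhole and divisibility, under all rationals, and ergodicity forces its mass to be near \<open>0\<close> or \<open>1\<close>.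

Ergodicity is used in the form \<open>decorrelated\<close>, the averaged independence of a set from all others. A mean with this
property for countably many sets is found without ergodic theory by maximising a strictly convex functional of
the masses of these sets (\<open>maximal_energy_decorrelated\<close>).\<close>

section \<open>Bounded functions and universal limits\<close>

definition bounded_fun :: "('a \<Rightarrow> real) \<Rightarrow> bool" where
  "bounded_fun f \<longleftrightarrow> (\<exists>M. \<forall>x. \<bar>f x\<bar> \<le> M)"

lemma bounded_funI: "(\<And>x. \<bar>f x\<bar> \<le> M) \<Longrightarrow> bounded_fun f"
  by (auto simp: bounded_fun_def)

lemma bounded_fun_const [simp]: "bounded_fun (\<lambda>x. c)"
  by (auto simp: bounded_fun_def)

lemma bounded_fun_indicator [simp]: "bounded_fun (indicat_real S)"
  by (rule bounded_funI[of _ 1]) (auto simp: indicator_def)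

lemma bounded_fun_add [simp]:
  assumes "bounded_fun f" "bounded_fun g" shows "bounded_fun (\<lambda>x. f x + g x)"
proof -
  obtain M N where "\<And>x. \<bar>f x\<bar> \<le> M" "\<And>x. \<bar>g x\<bar> \<le> N"
    using assms by (auto simp: bounded_fun_def)
  then have "\<bar>f x + g x\<bar> \<le> M + N" for x
    using abs_triangle_ineq[of "f x" "g x"] by (meson add_mono order_trans)
  then show ?thesis by (rule bounded_funI)
qed

lemma bounded_fun_mult [simp]:
  assumes "bounded_fun f" "bounded_fun g" shows "bounded_fun (\<lambda>x. f x * g x)"
proof -
  obtain M N where MN: "\<And>x. \<bar>f x\<bar> \<le> M" "\<And>x. \<bar>g x\<bar> \<le> N"
    using assms by (auto simp: bounded_fun_def)
  have "\<bar>f x * g x\<bar> \<le> M * N" for x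
    using mult_mono[OF MN(1)[of x] MN(2)[of x]] MN(1)[of x] by (auto simp: abs_mult)
  then show ?thesis by (rule bounded_funI)
qed

lemma bounded_fun_minus [simp]:
  assumes "bounded_fun f" "bounded_fun g" shows "bounded_fun (\<lambda>x. f x - g x)"
  using bounded_fun_add[OF assms(1) bounded_fun_mult[OF bounded_fun_const[of "-1"] assms(2)]]
  by simp

lemma bounded_fun_sum [simp]:
  assumes "\<And>i. i \<in> E \<Longrightarrow> bounded_fun (f i)" shows "bounded_fun (\<lambda>x. \<Sum>i\<in>E. f i x)"
  using assms by (induction E rule: infinite_finite_induct) auto

lemma bounded_fun_comp: "bounded_fun f \<Longrightarrow> bounded_fun (\<lambda>x. f (h x))"
  by (auto simp: bounded_fun_def)

lemma compact_cube: "compact (PiE (UNIV::'i set) (\<lambda>_. {-1..1::real}))"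
  using compactin_PiE[of "\<lambda>_. euclidean" UNIV "\<lambda>_::'i. {-1..1::real}"]
  by (simp add: euclidean_product_topology)

text \<open>The cube of all \<open>[-1,1]\<close>-valued functions on the set of all real sequences is compact, so the points
\<open>\<phi> n\<close> that evaluate every (clipped) sequence at \<open>n\<close> accumulate somewhere. Along a filter on the indices
that makes them converge to an accumulation point, all bounded sequences converge simultaneously.\<close>

lemma ex_universal_filter:
  "\<exists>G. G \<le> sequentially \<and> G \<noteq> bot \<and>
     (\<forall>s::nat \<Rightarrow> real. bounded_fun s \<longrightarrow> (\<exists>l. (s \<longlongrightarrow> l) G))"
proof -
  define \<phi> :: "nat \<Rightarrow> (nat \<Rightarrow> real) \<Rightarrow> real" where "\<phi> = (\<lambda>n s. max (-1) (min 1 (s n)))"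
  define F where "F = filtermap \<phi> sequentially"
  have "F \<le> principal (PiE UNIV (\<lambda>_. {-1..1}))"
    unfolding F_def le_principal by (auto simp: eventually_filtermap \<phi>_def PiE_iff intro!: always_eventually)
  moreover have "F \<noteq> bot" by (simp add: F_def filtermap_bot_iff)
  ultimately obtain x where x: "inf (nhds x) F \<noteq> bot"
    using compact_cube[where 'i="nat \<Rightarrow> real"] unfolding compact_filter le_principal by blast
  define G where "G = inf (filtercomap \<phi> (nhds x)) sequentially"
  have "G \<noteq> bot"
  proof
    assume "G = bot"
    then have "eventually (\<lambda>_. False) G" by simp
    then obtain P Q where PQ: "eventually P (filtercomap \<phi> (nhds x))" "eventually Q sequentially"
      "\<And>n. P n \<Longrightarrow> Q n \<Longrightarrow> False"
      unfolding G_def eventually_inf by auto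
    then obtain R where R: "eventually R (nhds x)" "\<And>n. R (\<phi> n) \<Longrightarrow> P n"
      by (auto simp: eventually_filtercomap)
    have "eventually (\<lambda>y. \<exists>n. y = \<phi> n \<and> Q n) F"
      unfolding F_def eventually_filtermap by (rule eventually_mono[OF PQ(2)]) auto
    then have "eventually (\<lambda>_. False) (inf (nhds x) F)"
      unfolding eventually_inf using R PQ(3) by blast
    with x show False by (simp add: trivial_limit_def)
  qed
  have lim: "filterlim \<phi> (nhds x) G"
    unfolding G_def by (meson filterlim_filtercomap filterlim_inf filterlim_mono inf_le1 order_refl)
  have coord: "((\<lambda>n. \<phi> n s) \<longlongrightarrow> x s) G" for s
  proof -
    have "continuous_on UNIV (\<lambda>y::(nat \<Rightarrow> real) \<Rightarrow> real. y s)"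
      by (rule continuous_on_product_coordinates)
    from continuous_on_tendsto_compose[OF this lim] show ?thesis by simp
  qed
  have "\<exists>l. (s \<longlongrightarrow> l) G" if s: "bounded_fun s" for s
  proof -
    obtain M where M: "\<And>n. \<bar>s n\<bar> \<le> M" using s by (auto simp: bounded_fun_def)
    define N where "N = M + 1"
    have N: "N > 0" "\<bar>s n\<bar> \<le> N" for n using M[of n] by (auto simp: N_def)
    have "\<phi> n (\<lambda>k. s k / N) = s n / N" for n
      using N(2)[of n] N(1) by (auto simp: \<phi>_def abs_le_iff min_def max_def field_simps)
    with coord[of "\<lambda>k. s k / N"] have "((\<lambda>n. s n / N) \<longlongrightarrow> x (\<lambda>k. s k / N)) G" by simp
    from tendsto_mult_right[OF this, of N] N(1) show ?thesis by auto
  qed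
  moreover have "G \<le> sequentially" by (simp add: G_def)
  ultimately show ?thesis using \<open>G \<noteq> bot\<close> by blast
qed

text \<open>This filter serves as a nonprincipal ultrafilter: \<open>universal_filter_ultra\<close> is the ultrafilter dichotomy.\<close>

definition universal_filter :: "nat filter" where
  "universal_filter = (SOME G. G \<le> sequentially \<and> G \<noteq> bot \<and>
     (\<forall>s::nat \<Rightarrow> real. bounded_fun s \<longrightarrow> (\<exists>l. (s \<longlongrightarrow> l) G)))"

definition glim :: "(nat \<Rightarrow> real) \<Rightarrow> real" where
  "glim s = Lim universal_filter s"

lemma universal_filter_le: "universal_filter \<le> sequentially"
  and universal_filter_nontrivial [simp]: "universal_filter \<noteq> bot"
  and ex_limit_universal_filter:
    "bounded_fun s \<Longrightarrow> \<exists>l. (s \<longlongrightarrow> l) universal_filter"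
  using someI_ex[OF ex_universal_filter] unfolding universal_filter_def by blast+

lemma tendsto_glim: "bounded_fun s \<Longrightarrow> (s \<longlongrightarrow> glim s) universal_filter"
  using ex_limit_universal_filter tendsto_Lim unfolding glim_def
  by (metis universal_filter_nontrivial)

lemma glim_eqI: "(s \<longlongrightarrow> l) universal_filter \<Longrightarrow> glim s = l"
  by (simp add: glim_def tendsto_Lim)

lemma eventually_universal_filter:
  "eventually P sequentially \<Longrightarrow> eventually P universal_filter"
  using universal_filter_le by (rule filter_leD)

lemma tendsto_universal_filter: "s \<longlonglongrightarrow> l \<Longrightarrow> (s \<longlongrightarrow> l) universal_filter"
  using universal_filter_le by (rule tendsto_mono)

lemma universal_filter_ultra:
  "eventually P universal_filter \<or> eventually (\<lambda>n. \<not> P n) universal_filter"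
proof -
  let ?s = "indicat_real {n. P n}"
  have lim: "(?s \<longlongrightarrow> glim ?s) universal_filter" by (rule tendsto_glim) simp
  show ?thesis
  proof (cases "glim ?s > 0")
    case True
    from order_tendstoD(1)[OF lim this] show ?thesis
      by (intro disjI1) (auto elim!: eventually_mono simp: indicator_def split: if_splits)
  next
    case False
    then have "glim ?s < 1" by simp
    from order_tendstoD(2)[OF lim this] show ?thesis
      by (intro disjI2) (auto elim!: eventually_mono simp: indicator_def split: if_splits)
  qed
qed

section \<open>Finitely additive means\<close>

text \<open>Finitely additive probabilities, in the form of their integrals: with functionals instead of set functions, iterated
averages such as \<open>I (\<lambda>x. I (f x))\<close> need no separate theory of integration. The functional is total, but only bounded
functions are integrable, hence the guards.\<close>

locale fin_mean =
  fixes I :: "('g \<Rightarrow> real) \<Rightarrow> real"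
  assumes add: "\<And>f g. bounded_fun f \<Longrightarrow> bounded_fun g \<Longrightarrow> I (\<lambda>x. f x + g x) = I f + I g"
    and scale: "\<And>c f. bounded_fun f \<Longrightarrow> I (\<lambda>x. c * f x) = c * I f"
    and nonneg: "\<And>f. bounded_fun f \<Longrightarrow> (\<And>x. f x \<ge> 0) \<Longrightarrow> I f \<ge> 0"
    and one: "I (\<lambda>_. 1) = 1"
begin

lemma const: "I (\<lambda>_. c) = c"
  using scale[of "\<lambda>_. 1" c] one by simp

lemma diff: "bounded_fun f \<Longrightarrow> bounded_fun g \<Longrightarrow> I (\<lambda>x. f x - g x) = I f - I g"
  using add[of f "\<lambda>x. (-1) * g x"] scale[of g "-1"] bounded_fun_mult[of "\<lambda>_. -1" g] by simp

lemma mono: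
  assumes "bounded_fun f" "bounded_fun g" "\<And>x. f x \<le> g x" shows "I f \<le> I g"
  using nonneg[of "\<lambda>x. g x - f x"] diff[of g f] assms by simp

lemma abs_bound:
  assumes "\<And>x. \<bar>f x\<bar> \<le> M" shows "\<bar>I f\<bar> \<le> M"
proof -
  have b: "bounded_fun f" using assms by (rule bounded_funI)
  have "I f \<le> I (\<lambda>_. M)" by (rule mono) (use b assms abs_le_D1 in auto)
  moreover have "I (\<lambda>_. -M) \<le> I f" by (rule mono) (use b assms in \<open>auto simp: abs_le_iff minus_le_iff\<close>)
  ultimately show ?thesis by (simp add: const)
qed

lemma sum: "(\<And>i. i \<in> E \<Longrightarrow> bounded_fun (f i)) \<Longrightarrow> I (\<lambda>x. \<Sum>i\<in>E. f i x) = (\<Sum>i\<in>E. I (f i))"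
  by (induction E rule: infinite_finite_induct) (auto simp: add const)

definition mass :: "'g set \<Rightarrow> real" where "mass S = I (indicator S)"

lemma mass_nonneg: "0 \<le> mass S"
  unfolding mass_def by (rule nonneg) auto

lemma mass_mono: "S \<subseteq> T \<Longrightarrow> mass S \<le> mass T"
  unfolding mass_def by (rule mono) (auto simp: indicator_def)

lemma mass_UNIV: "mass UNIV = 1"
  using one by (simp add: mass_def)

lemma mass_le_1: "mass S \<le> 1"
  using mass_mono[of S UNIV] mass_UNIV by simp

lemma mass_empty: "mass {} = 0"
proof -
  have "indicat_real {} = (\<lambda>_::'g. 0)" by (simp add: fun_eq_iff)
  then show ?thesis by (simp add: mass_def const)
qed

lemma mass_Un_Int: "mass (S \<union> T) + mass (S \<inter> T) = mass S + mass T"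
proof -
  have "indicat_real S x + indicat_real T x = indicat_real (S \<union> T) x + indicat_real (S \<inter> T) x" for x
    by (auto simp: indicator_def)
  then have "I (\<lambda>x. indicat_real S x + indicat_real T x)
      = I (\<lambda>x. indicat_real (S \<union> T) x + indicat_real (S \<inter> T) x)" by presburger
  then show ?thesis unfolding mass_def by (simp add: add)
qed

lemma mass_Un_le: "mass (S \<union> T) \<le> mass S + mass T"
  using mass_Un_Int[of S T] mass_nonneg[of "S \<inter> T"] by simp

lemma mass_disjoint_Un: "S \<inter> T = {} \<Longrightarrow> mass (S \<union> T) = mass S + mass T"
  using mass_Un_Int[of S T] mass_empty by simp

lemma mass_Diff: "mass (S - T) = mass S - mass (S \<inter> T)"
proof -
  have "mass ((S - T) \<union> (S \<inter> T)) = mass (S - T) + mass (S \<inter> T)"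
    by (rule mass_disjoint_Un) auto
  then show ?thesis by (simp add: Un_Diff_Int)
qed

lemma mass_disjoint_UN:
  assumes "finite E" "disjoint_family_on X E"
  shows "mass (\<Union>i\<in>E. X i) = (\<Sum>i\<in>E. mass (X i))"
  using assms
proof (induction E rule: finite_induct)
  case (insert i E)
  have "X i \<inter> (\<Union>i\<in>E. X i) = {}"
    using insert by (auto simp: disjoint_family_on_def)
  with insert show ?case by (simp add: mass_disjoint_Un disjoint_family_on_insert)
qed (simp add: mass_empty)

end

text \<open>This replaces weak compactness of the space of means: every sequence of means has a limit mean, evaluated along the
universal filter.\<close>

lemma fin_mean_glim:
  fixes J :: "nat \<Rightarrow> ('g \<Rightarrow> real) \<Rightarrow> real"
  assumes "\<And>n. fin_mean (J n)"
  shows "fin_mean (\<lambda>f. glim (\<lambda>n. J n f))"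
    and "\<And>f. bounded_fun f \<Longrightarrow> ((\<lambda>n. J n f) \<longlongrightarrow> glim (\<lambda>n. J n f)) universal_filter"
proof -
  show lim: "((\<lambda>n. J n f) \<longlongrightarrow> glim (\<lambda>n. J n f)) universal_filter" if f: "bounded_fun f" for f
  proof -
    obtain M where "\<And>x. \<bar>f x\<bar> \<le> M" using f by (auto simp: bounded_fun_def)
    then have "bounded_fun (\<lambda>n. J n f)"
      using fin_mean.abs_bound[OF assms] by (intro bounded_funI[of _ M]) blast
    then show ?thesis by (rule tendsto_glim)
  qed
  show "fin_mean (\<lambda>f. glim (\<lambda>n. J n f))"
  proof
    fix f g :: "'g \<Rightarrow> real" assume b: "bounded_fun f" "bounded_fun g"
    show "glim (\<lambda>n. J n (\<lambda>x. f x + g x)) = glim (\<lambda>n. J n f) + glim (\<lambda>n. J n g)"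
      using tendsto_add[OF lim lim, OF b] by (intro glim_eqI) (simp add: fin_mean.add[OF assms b])
  next
    fix c and f :: "'g \<Rightarrow> real" assume b: "bounded_fun f"
    show "glim (\<lambda>n. J n (\<lambda>x. c * f x)) = c * glim (\<lambda>n. J n f)"
      using tendsto_mult_left[OF lim[OF b], of c]
      by (intro glim_eqI) (simp add: fin_mean.scale[OF assms b])
  next
    fix f :: "'g \<Rightarrow> real" assume b: "bounded_fun f" and "\<And>x. 0 \<le> f x"
    then show "0 \<le> glim (\<lambda>n. J n f)"
      by (intro tendsto_lowerbound[OF lim[OF b]]) (auto simp: fin_mean.nonneg[OF assms])
  next
    show "glim (\<lambda>n. J n (\<lambda>_. 1)) = 1"
      by (intro glim_eqI) (simp add: fin_mean.one[OF assms])
  qed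
qed

lemma fin_mean_average:
  assumes "finite W" "W \<noteq> {}"
  shows "fin_mean (\<lambda>f. (\<Sum>x\<in>W. f (h x)) / real (card W))"
  by standard
    (use assms in \<open>auto simp: sum.distrib add_divide_distrib sum_distrib_left sum_nonneg\<close>)

section \<open>Extremal invariant means decorrelate sets\<close>

locale invariant_mean = fin_mean I for I :: "('g::ab_group_add \<Rightarrow> real) \<Rightarrow> real" +
  assumes invariant: "\<And>f t. bounded_fun f \<Longrightarrow> I (\<lambda>x. f (t + x)) = I f"

lemma bounded_fun_translate [simp]: "bounded_fun f \<Longrightarrow> bounded_fun (\<lambda>y. f (t + y))"
  by (rule bounded_fun_comp)

definition shift :: "'g::ab_group_add \<Rightarrow> 'g set \<Rightarrow> 'g set" where
  "shift x A = {y. x + y \<in> A}"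

lemma shift_shift: "shift x (shift y A) = shift (x + y) A"
  by (auto simp: shift_def ac_simps)

lemma shift_0 [simp]: "shift 0 A = A"
  by (simp add: shift_def)

lemma shift_Int: "shift x (A \<inter> B) = shift x A \<inter> shift x B"
  and shift_Diff: "shift x (A - B) = shift x A - shift x B"
  by (auto simp: shift_def)

lemma (in invariant_mean) mass_shift: "mass (shift x A) = mass A"
proof -
  have "indicat_real (shift x A) = (\<lambda>y. indicator A (x + y))"
    by (auto simp: shift_def indicator_def)
  then show ?thesis using invariant[of "indicator A" x] by (simp add: mass_def)
qed

lemma invariant_mean_glim:
  fixes J :: "nat \<Rightarrow> ('g::ab_group_add \<Rightarrow> real) \<Rightarrow> real"
  assumes "\<And>n. invariant_mean (J n)"
  shows "invariant_mean (\<lambda>f. glim (\<lambda>n. J n f))"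
proof -
  have "fin_mean (J n)" for n using assms by (simp add: invariant_mean_def)
  then interpret L: fin_mean "\<lambda>f. glim (\<lambda>n. J n f)" by (rule fin_mean_glim)
  show ?thesis
    by unfold_locales (simp add: invariant_mean.invariant[OF assms])
qed

text \<open>Squares make this functional strictly convex in the values \<open>J (indicator (S j))\<close>, so that its maximisers among the
invariant means behave, on the sets \<open>S j\<close>, like extreme points. The weights are geometric so that, for
small \<open>c\<close>, the set \<open>S 0\<close> dominates.\<close>

definition energy :: "real \<Rightarrow> (nat \<Rightarrow> 'g set) \<Rightarrow> (('g \<Rightarrow> real) \<Rightarrow> real) \<Rightarrow> real" where
  "energy c S J = (\<Sum>j. c ^ j * (J (indicator (S j)))\<^sup>2)"

lemma (in fin_mean)
  assumes c: "0 < c" "c < 1"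
  shows summable_energy: "summable (\<lambda>j. c ^ j * (I (indicator (S j)))\<^sup>2)"
    and energy_term_le: "norm (c ^ j * (I (indicator (S j)))\<^sup>2) \<le> c ^ j"
proof -
  show le: "norm (c ^ j * (I (indicator (S j)))\<^sup>2) \<le> c ^ j" for j
    using mass_nonneg[of "S j"] mass_le_1[of "S j"] c
    by (simp add: mass_def abs_mult mult_left_le power_le_one)
  show "summable (\<lambda>j. c ^ j * (I (indicator (S j)))\<^sup>2)"
    by (rule summable_comparison_test'[OF summable_geometric[of c] le]) (use c in auto)
qed

text \<open>The energy is continuous along universal limits by dominated convergence, so the limit of a maximising sequence
attains the supremum.\<close>

lemma ex_maximal_energy:
  fixes S :: "nat \<Rightarrow> 'g::ab_group_add set"
  assumes c: "0 < c" "c < 1" and I0: "invariant_mean (I0 :: ('g \<Rightarrow> real) \<Rightarrow> real)"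
  shows "\<exists>I. invariant_mean I \<and> (\<forall>J. invariant_mean J \<longrightarrow> energy c S J \<le> energy c S I)"
proof -
  let ?E = "energy c S ` Collect invariant_mean"
  have fm: "fin_mean J" if "invariant_mean J" for J :: "('g \<Rightarrow> real) \<Rightarrow> real"
    using that by (simp add: invariant_mean_def)
  have "energy c S J \<le> (\<Sum>j. c ^ j)" if "invariant_mean J" for J
    unfolding energy_def
    using fin_mean.energy_term_le[OF fm[OF that] c] fin_mean.summable_energy[OF fm[OF that] c]
    by (intro suminf_le) (use c in \<open>auto simp: abs_le_iff\<close>)
  then have bdd: "bdd_above ?E" by (intro bdd_aboveI2) auto
  have ex: "\<exists>J. invariant_mean J \<and> Sup ?E - 1 / real (Suc n) < energy c S J" for n
  proof -
    have "energy c S I0 \<in> ?E" using I0 by simp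
    then have "?E \<noteq> {}" by auto
    moreover have "Sup ?E - 1 / real (Suc n) < Sup ?E" by simp
    ultimately have "\<exists>z\<in>?E. Sup ?E - 1 / real (Suc n) < z" by (rule less_cSupD)
    then show ?thesis by (simp only: bex_simps(7) mem_Collect_eq) blast
  qed
  define J where "J n = (SOME J. invariant_mean J \<and> Sup ?E - 1 / real (Suc n) < energy c S J)" for n
  have J: "invariant_mean (J n)" "Sup ?E - 1 / real (Suc n) < energy c S (J n)" for n
    using someI_ex[OF ex[of n]] unfolding J_def by simp_all
  have J_le: "energy c S (J n) \<le> Sup ?E" for n
    using J(1) by (intro cSup_upper bdd) simp
  define I where "I = (\<lambda>f. glim (\<lambda>n. J n f))"
  have I: "invariant_mean I" unfolding I_def using J(1) by (rule invariant_mean_glim)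
  have low: "(\<lambda>n. Sup ?E - 1 / real (Suc n)) \<longlonglongrightarrow> Sup ?E - 0"
    by (rule tendsto_diff[OF tendsto_const LIMSEQ_Suc[OF lim_1_over_n]])
  have "(\<lambda>n. energy c S (J n)) \<longlonglongrightarrow> Sup ?E"
  proof (rule tendsto_sandwich)
    show "(\<lambda>n. Sup ?E - 1 / real (Suc n)) \<longlonglongrightarrow> Sup ?E" using low by simp
    show "\<forall>\<^sub>F n in sequentially. Sup ?E - 1 / real (Suc n) \<le> energy c S (J n)"
      by (rule always_eventually) (use less_imp_le[OF J(2)] in blast)
    show "\<forall>\<^sub>F n in sequentially. energy c S (J n) \<le> Sup ?E"
      by (rule always_eventually) (use J_le in blast)
  qed (rule tendsto_const)
  then have lim1: "((\<lambda>n. energy c S (J n)) \<longlongrightarrow> Sup ?E) universal_filter"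
    by (rule tendsto_universal_filter)
  have "((\<lambda>n. \<Sum>j. c ^ j * (J n (indicator (S j)))\<^sup>2)
      \<longlongrightarrow> (\<Sum>j. c ^ j * (I (indicator (S j)))\<^sup>2)) universal_filter"
  proof (rule tannerys_theorem[THEN conjunct2, THEN conjunct2])
    show "((\<lambda>n. c ^ j * (J n (indicator (S j)))\<^sup>2) \<longlongrightarrow> c ^ j * (I (indicator (S j)))\<^sup>2) universal_filter" for j
      unfolding I_def
      by (rule tendsto_mult_left[OF tendsto_power[OF fin_mean_glim(2)[OF fm[OF J(1)]]]]) simp
    show "\<forall>\<^sub>F (j, n) in at_top \<times>\<^sub>F universal_filter. norm (c ^ j * (J n (indicator (S j)))\<^sup>2) \<le> c ^ j"
      using fin_mean.energy_term_le[OF fm[OF J(1)] c] by (intro always_eventually) auto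
  qed (use c in auto)
  then have "energy c S I = Sup ?E"
    using lim1 tendsto_unique[OF universal_filter_nontrivial] unfolding energy_def by blast
  moreover have "energy c S J \<le> Sup ?E" if "invariant_mean J" for J
    using that by (intro cSup_upper bdd) simp
  ultimately show ?thesis using I by auto
qed

text \<open>For the mean of an ergodic system this is the conclusion of the mean ergodic theorem: averaged over all shifts \<open>x\<close>, the
set \<open>shift x A\<close> is independent of any set \<open>B\<close>.\<close>

definition decorrelated :: "(('g::ab_group_add \<Rightarrow> real) \<Rightarrow> real) \<Rightarrow> 'g set \<Rightarrow> bool" where
  "decorrelated I A \<longleftrightarrow>
     (\<forall>B. I (\<lambda>x. I (indicator (B \<inter> shift x A))) = I (indicator B) * I (indicator A))"

text \<open>Averaging the mean \<open>f \<mapsto> I (indicator B * f)\<close> over all translations gives an invariant functional \<open>Q\<close> with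
\<open>0 \<le> Q \<le> I\<close> and \<open>Q 1 = I (indicator B)\<close>. Hence \<open>I \<plusminus> (Q - Q 1 * I)\<close> are both invariant means with midpoint
\<open>I\<close>. By the parallelogram identity their energies average to that of \<open>I\<close> plus the energy of the
perturbation, so the perturbation of a maximiser vanishes on every \<open>S j\<close>, which is decorrelation.\<close>

lemma maximal_energy_decorrelated:
  fixes S :: "nat \<Rightarrow> 'g::ab_group_add set"
  assumes c: "0 < c" "c < 1" and I: "invariant_mean I"
    and max: "\<And>J. invariant_mean J \<Longrightarrow> energy c S J \<le> energy c S I"
  shows "decorrelated I (S j)"
  unfolding decorrelated_def
proof
  fix B :: "'g set"
  interpret invariant_mean I by (fact I)
  define \<beta> where "\<beta> = I (indicator B)"
  define q where "q = (\<lambda>f x. I (\<lambda>y. indicator B y * f (x + y)))"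
  define Q where "Q = (\<lambda>f. I (q f))"
  have \<beta>: "0 \<le> \<beta>" "\<beta> \<le> 1" using mass_nonneg[of B] mass_le_1[of B] by (auto simp: \<beta>_def mass_def)
  have q_bdd [simp]: "bounded_fun (q f)" if "bounded_fun f" for f
  proof -
    obtain M where M: "\<And>x. \<bar>f x\<bar> \<le> M" using \<open>bounded_fun f\<close> by (auto simp: bounded_fun_def)
    have "\<bar>q f x\<bar> \<le> M" for x
      unfolding q_def using M by (intro abs_bound) (auto simp: indicator_def intro: order_trans[OF abs_ge_zero])
    then show ?thesis by (rule bounded_funI)
  qed
  have Q_add: "Q (\<lambda>x. f x + g x) = Q f + Q g" if "bounded_fun f" "bounded_fun g" for f g
  proof -
    have "q (\<lambda>x. f x + g x) = (\<lambda>x. q f x + q g x)"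
      using that unfolding q_def by (simp add: distrib_left add)
    then show ?thesis using that by (simp add: Q_def add)
  qed
  have Q_scale: "Q (\<lambda>x. a * f x) = a * Q f" if "bounded_fun f" for f a
  proof -
    have "q (\<lambda>x. a * f x) = (\<lambda>x. a * q f x)"
      using that unfolding q_def by (simp add: mult.left_commute scale)
    then show ?thesis using that by (simp add: Q_def scale)
  qed
  have Q_bounds: "0 \<le> Q f \<and> Q f \<le> I f" if "bounded_fun f" "\<And>x. f x \<ge> 0" for f
  proof -
    have "0 \<le> q f x" for x unfolding q_def using that by (intro nonneg) auto
    then have "0 \<le> Q f" using that unfolding Q_def by (intro nonneg) auto
    moreover have "q f x \<le> I f" for x
    proof -
      have "q f x \<le> I (\<lambda>y. f (x + y))"
        unfolding q_def
      proof (rule mono)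
        show "indicator B y * f (x + y) \<le> f (x + y)" for y
          using that(2) by (simp add: indicator_def)
      qed (use that(1) in simp_all)
      then show ?thesis using invariant[OF that(1), of x] by simp
    qed
    then have "Q f \<le> I (\<lambda>x. I f)" using that unfolding Q_def by (intro mono) auto
    ultimately show ?thesis by (simp add: const)
  qed
  have Q_one: "Q (\<lambda>_. 1) = \<beta>"
    by (simp add: Q_def q_def const \<beta>_def)
  have Q_inv: "Q (\<lambda>x. f (t + x)) = Q f" if "bounded_fun f" for f t
  proof -
    have "q (\<lambda>x. f (t + x)) = (\<lambda>x. q f (t + x))" by (simp add: q_def add.assoc)
    then show ?thesis using invariant[OF q_bdd[OF that], of t] by (simp add: Q_def)
  qed
  have J: "invariant_mean (\<lambda>f. I f + s * (Q f - \<beta> * I f))" if s: "s = 1 \<or> s = -1" for s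
  proof
    fix f g :: "'g \<Rightarrow> real" and a t
    assume f: "bounded_fun f"
    show "I (\<lambda>x. f (t + x)) + s * (Q (\<lambda>x. f (t + x)) - \<beta> * I (\<lambda>x. f (t + x)))
        = I f + s * (Q f - \<beta> * I f)"
      using invariant[OF f, of t] Q_inv[OF f, of t] by simp
    show "I (\<lambda>x. a * f x) + s * (Q (\<lambda>x. a * f x) - \<beta> * I (\<lambda>x. a * f x)) =
        a * (I f + s * (Q f - \<beta> * I f))" using f by (simp add: scale Q_scale algebra_simps)
    show "I (\<lambda>x. f x + g x) + s * (Q (\<lambda>x. f x + g x) - \<beta> * I (\<lambda>x. f x + g x)) =
        I f + s * (Q f - \<beta> * I f) + (I g + s * (Q g - \<beta> * I g))" if "bounded_fun g"
      using f that by (simp add: add Q_add algebra_simps)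
    show "0 \<le> I f + s * (Q f - \<beta> * I f)" if "\<And>x. 0 \<le> f x"
    proof -
      have "0 \<le> \<beta> * I f" "\<beta> * I f \<le> I f"
        using \<beta> nonneg[OF f that] by (auto intro: mult_left_le_one_le)
      then show ?thesis using Q_bounds[OF f that] s by auto
    qed
  next
    show "I (\<lambda>_. 1) + s * (Q (\<lambda>_. 1) - \<beta> * I (\<lambda>_. 1)) = 1" by (simp add: one Q_one)
  qed
  define \<Delta> where "\<Delta> j = Q (indicator (S j)) - \<beta> * I (indicator (S j))" for j
  have J1: "invariant_mean (\<lambda>f. I f + (Q f - \<beta> * I f))" (is "invariant_mean ?P")
    and J2: "invariant_mean (\<lambda>f. I f - (Q f - \<beta> * I f))" (is "invariant_mean ?N")
  proof -
    have "?P = (\<lambda>f. I f + 1 * (Q f - \<beta> * I f))" by simp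
    then show "invariant_mean ?P" using J[of 1] by simp
    have "?N = (\<lambda>f. I f + (-1) * (Q f - \<beta> * I f))" by (intro ext) (simp add: algebra_simps)
    then show "invariant_mean ?N" using J[of "-1"] by metis
  qed
  have fm: "fin_mean ?P" "fin_mean ?N" using J1 J2 by (simp_all add: invariant_mean_def)
  note sums = summable_energy[OF c, of S] fin_mean.summable_energy[OF fm(1) c, of S]
     fin_mean.summable_energy[OF fm(2) c, of S]
  \<comment> \<open>the parallelogram identity, term by term\<close>
  have eq: "c ^ j * (\<Delta> j)\<^sup>2 = ((c ^ j * (?P (indicator (S j)))\<^sup>2 + c ^ j * (?N (indicator (S j)))\<^sup>2)
       - 2 * (c ^ j * (I (indicator (S j)))\<^sup>2)) / 2" for j
    unfolding \<Delta>_def by (simp add: power2_eq_square algebra_simps)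
  have "(\<lambda>j. c ^ j * (\<Delta> j)\<^sup>2) sums ((energy c S ?P + energy c S ?N - 2 * energy c S I) / 2)"
    unfolding eq energy_def using sums
    by (intro sums_divide sums_diff sums_add sums_mult summable_sums)
  moreover have "(energy c S ?P + energy c S ?N - 2 * energy c S I) / 2 \<le> 0"
    using max[OF J1] max[OF J2] by simp
  ultimately have sm: "summable (\<lambda>j. c ^ j * (\<Delta> j)\<^sup>2)" and "(\<Sum>j. c ^ j * (\<Delta> j)\<^sup>2) \<le> 0"
    by (auto simp: sums_iff)
  moreover have "0 \<le> (\<Sum>j. c ^ j * (\<Delta> j)\<^sup>2)" using sm c by (intro suminf_nonneg) auto
  ultimately have "c ^ j * (\<Delta> j)\<^sup>2 = 0"
    using suminf_eq_zero_iff[OF sm] c by auto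
  then have "Q (indicator (S j)) = \<beta> * I (indicator (S j))" using c by (simp add: \<Delta>_def)
  moreover have "Q (indicator (S j)) = I (\<lambda>x. I (indicator (B \<inter> shift x (S j))))"
    unfolding Q_def q_def by (intro arg_cong[of _ _ I] ext) (auto simp: shift_def indicator_def)
  ultimately show "I (\<lambda>x. I (indicator (B \<inter> shift x (S j)))) = I (indicator B) * I (indicator (S j))"
    by (simp add: \<beta>_def)
qed

text \<open>The mass of the distinguished set \<open>S 0\<close> hardly drops on passing to a maximiser: its square has weight \<open>1\<close> in the
energy, and all other terms together contribute at most \<open>c / (1 - c)\<close>.\<close>

theorem ex_decorrelated_mean:
  fixes S :: "nat \<Rightarrow> 'g::ab_group_add set"
  assumes I0: "invariant_mean I0" and d: "0 \<le> d" "d < I0 (indicator (S 0))"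
  shows "\<exists>I. invariant_mean I \<and> d < I (indicator (S 0)) \<and> (\<forall>j. decorrelated I (S j))"
proof -
  define \<delta> where "\<delta> = (I0 (indicator (S 0)))\<^sup>2 - d\<^sup>2"
  have "d\<^sup>2 < (I0 (indicator (S 0)))\<^sup>2" using d by (simp add: power_strict_mono)
  then have \<delta>: "\<delta> > 0" by (simp add: \<delta>_def)
  \<comment> \<open>chosen so that \<open>c / (1 - c) = \<delta> / 2\<close>\<close>
  define c where "c = \<delta> / (2 + \<delta>)"
  have "1 - c = 2 / (2 + \<delta>)" using \<delta> by (simp add: c_def field_simps)
  then have c: "0 < c" "c < 1" "c / (1 - c) < \<delta>" using \<delta> by (simp_all add: c_def)
  obtain I where I: "invariant_mean I"
    and max: "\<And>J. invariant_mean J \<Longrightarrow> energy c S J \<le> energy c S I"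
    using ex_maximal_energy[OF c(1,2) I0, of S] by blast
  have fm: "fin_mean I" "fin_mean I0" using I I0 by (simp_all add: invariant_mean_def)
  have split: "energy c S J = (J (indicator (S 0)))\<^sup>2 + (\<Sum>j. c ^ Suc j * (J (indicator (S (Suc j))))\<^sup>2)"
    if "fin_mean J" for J
    unfolding energy_def using suminf_split_head[OF fin_mean.summable_energy[OF that c(1,2)], of S] by simp
  have tail: "summable (\<lambda>j. c ^ Suc j * (J (indicator (S (Suc j))))\<^sup>2)" if "fin_mean J" for J
    using summable_Suc_iff[THEN iffD2, OF fin_mean.summable_energy[OF that c(1,2), of S]] .
  have "(\<Sum>j. c ^ Suc j * (I (indicator (S (Suc j))))\<^sup>2) \<le> (\<Sum>j. c ^ Suc j)"
  proof (rule suminf_le[OF _ tail[OF fm(1)]])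
    show "c ^ Suc j * (I (indicator (S (Suc j))))\<^sup>2 \<le> c ^ Suc j" for j
      using fin_mean.energy_term_le[OF fm(1) c(1,2), of "Suc j" S] by (simp only: real_norm_def abs_le_iff)
    show "summable (\<lambda>j. c ^ Suc j)"
      using summable_Suc_iff[THEN iffD2, OF summable_geometric[of c]] c by simp
  qed
  also have "\<dots> = c / (1 - c)"
    using suminf_mult[OF summable_geometric[of c], of c] suminf_geometric[of c] c by simp
  finally have "energy c S I < (I (indicator (S 0)))\<^sup>2 + \<delta>" using split[OF fm(1)] c by simp
  moreover have "(\<Sum>j. c ^ Suc j * (I0 (indicator (S (Suc j))))\<^sup>2) \<ge> 0"
    using c by (intro suminf_nonneg tail fm mult_nonneg_nonneg) auto
  then have "energy c S I0 \<ge> (I0 (indicator (S 0)))\<^sup>2" using split[OF fm(2)] by simp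
  ultimately have "d\<^sup>2 < (I (indicator (S 0)))\<^sup>2" using max[OF I0] by (simp add: \<delta>_def)
  moreover have "0 \<le> I (indicator (S 0))" using fin_mean.nonneg[OF fm(1)] by simp
  ultimately have "d < I (indicator (S 0))" using power_less_imp_less_base by blast
  then show ?thesis using I maximal_energy_decorrelated[OF c(1,2) I max] by blast
qed

section \<open>Sumsets of rationals\<close>

context invariant_mean
begin

text \<open>The mass of \<open>A - shift g A\<close> measures how far \<open>g\<close> is from being a period of \<open>A\<close>; it is subadditive in \<open>g\<close>.\<close>

lemma mass_Diff_shift_add:
  "mass (A - shift (g + h) A) \<le> mass (A - shift g A) + mass (A - shift h A)"
proof -
  have "A - shift (g + h) A \<subseteq> (A - shift g A) \<union> shift g (A - shift h A)"
    by (auto simp: shift_def ac_simps)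
  then have "mass (A - shift (g + h) A) \<le> mass ((A - shift g A) \<union> shift g (A - shift h A))"
    by (rule mass_mono)
  also have "\<dots> \<le> mass (A - shift g A) + mass (shift g (A - shift h A))"
    by (rule mass_Un_le)
  finally show ?thesis by (simp add: mass_shift)
qed

lemma mass_shift_Diff_shift: "mass (shift x A - shift y A) = mass (A - shift (y - x) A)"
proof -
  have "shift x A - shift y A = shift x (A - shift (y - x) A)"
    by (simp add: shift_Diff shift_shift)
  then show ?thesis by (simp add: mass_shift)
qed

lemma decorrelatedD:
  "decorrelated I A \<Longrightarrow> I (\<lambda>x. mass (B \<inter> shift x A)) = mass B * mass A"
  by (simp add: decorrelated_def mass_def)

lemma bounded_fun_mass: "bounded_fun (\<lambda>x. mass (X x))"
  using mass_nonneg mass_le_1 by (intro bounded_funI[of _ 1]) (simp add: abs_le_iff)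

text \<open>Let \<open>X\<close> be the set of shifts \<open>x\<close> for which \<open>shift x A\<close> meets \<open>B\<close>. For these, \<open>shift x A\<close> contains nearly all of \<open>B\<close>, so
decorrelation gives \<open>mass X * mass B \<approx> mass A * mass B\<close>. But \<open>X\<close> contains \<open>shift b A\<close> for each \<open>b\<close> in \<open>B\<close>, and
these sets have the mass of \<open>A\<close>. So each of them fills \<open>X\<close> up to a small error, and any two of them nearly agree.\<close>

lemma stuck_pair_almost_period:
  assumes A: "decorrelated I A"
    and stuck: "\<And>x. B \<inter> shift x A \<noteq> {} \<Longrightarrow> mass (B \<inter> shift x A) \<ge> mass B - \<epsilon>"
    and c: "c > 0" "c \<le> mass B" and \<epsilon>: "0 \<le> \<epsilon>" "\<epsilon> \<le> c / 2"
    and b: "b \<in> B" "b' \<in> B"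
  shows "mass (A - shift (b' - b) A) \<le> 2 * \<epsilon> / c"
proof -
  define X where "X = {x. B \<inter> shift x A \<noteq> {}}"
  have "I (\<lambda>x. (mass B - \<epsilon>) * indicator X x) \<le> I (\<lambda>x. mass (B \<inter> shift x A))"
    using stuck by (intro mono bounded_fun_mult bounded_fun_mass bounded_fun_indicator bounded_fun_const)
      (auto simp: X_def indicator_def mass_nonneg)
  then have X: "(mass B - \<epsilon>) * mass X \<le> mass B * mass A"
    using decorrelatedD[OF A, of B] by (simp add: scale flip: mass_def)
  have sub: "shift b A \<subseteq> X" if "b \<in> B" for b
    using that by (auto simp: X_def shift_def ac_simps)
  have "mass X - mass A \<le> 2 * \<epsilon> / c"
  proof -
    have "c / 2 * (mass X - mass A) \<le> (mass B - \<epsilon>) * (mass X - mass A)"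
      using c \<epsilon> mass_mono[OF sub[OF b(1)]] by (intro mult_right_mono) (auto simp: mass_shift)
    also have "\<dots> \<le> \<epsilon> * mass A" using X by (simp add: algebra_simps)
    also have "\<dots> \<le> \<epsilon> * 1" using mass_le_1 \<epsilon> by (intro mult_left_mono) auto
    finally show ?thesis using c by (simp add: field_simps)
  qed
  moreover have "mass (X - shift b' A) = mass X - mass A"
    using sub[OF b(2)] by (simp add: mass_Diff Int_absorb1 mass_shift)
  moreover have "mass (shift b A - shift b' A) \<le> mass (X - shift b' A)"
    using sub[OF b(1)] by (intro mass_mono) auto
  ultimately show ?thesis by (simp add: mass_shift_Diff_shift)
qed

end

text \<open>Pigeonhole: more than \<open>1 / mass B\<close> translates of \<open>B\<close> cannot be pairwise disjoint.\<close>

lemma ex_multiple_in_differences: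
  fixes I :: "(rat \<Rightarrow> real) \<Rightarrow> real"
  assumes I: "invariant_mean I" and K: "1 < real (Suc K) * fin_mean.mass I B"
  shows "\<exists>n b b'. 1 \<le> n \<and> n \<le> K \<and> b \<in> B \<and> b' \<in> B \<and> of_nat n * h = b' - b"
proof (rule ccontr)
  assume neg: "\<not> ?thesis"
  interpret invariant_mean I by (fact I)
  let ?X = "\<lambda>i::nat. shift (of_nat i * h) B"
  have "?X i \<inter> ?X j = {}" if "i < j" "j \<le> K" for i j
  proof (rule ccontr)
    assume "?X i \<inter> ?X j \<noteq> {}"
    then obtain y where "of_nat i * h + y \<in> B" "of_nat j * h + y \<in> B" by (auto simp: shift_def)
    moreover have "of_nat (j - i) * h = (of_nat j * h + y) - (of_nat i * h + y)"
      using that by (simp add: of_nat_diff algebra_simps)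
    moreover have "1 \<le> j - i" "j - i \<le> K" using that by auto
    ultimately show False using neg by blast
  qed
  then have "disjoint_family_on ?X {..K}"
    unfolding disjoint_family_on_def by (metis atMost_iff linorder_neqE_nat Int_commute)
  then have "mass (\<Union>i\<le>K. ?X i) = (\<Sum>i\<le>K. mass (?X i))" by (intro mass_disjoint_UN) auto
  also have "\<dots> = real (Suc K) * mass B" by (simp add: mass_shift)
  finally show False using K mass_le_1[of "\<Union>i\<le>K. ?X i"] by simp
qed

text \<open>This is where divisibility enters. Writing \<open>g = K! * h\<close>, some multiple \<open>n * h\<close> with \<open>1 \<le> n \<le> K\<close> is a difference of
elements of \<open>B\<close>, hence an almost period of \<open>A\<close>, and \<open>g\<close> is a sum of at most \<open>K!\<close> copies of it. The number of summands
does not depend on \<open>g\<close> or \<open>\<epsilon>\<close>, so all rationals are almost periods of \<open>A\<close> with a uniform error, while by decorrelation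
\<open>A \<inter> shift g A\<close> has mass \<open>(mass A)\<^sup>2\<close> on average over \<open>g\<close>.\<close>

lemma stuck_pair_zero_one:
  fixes I :: "(rat \<Rightarrow> real) \<Rightarrow> real"
  assumes I: "invariant_mean I" and A: "decorrelated I A"
    and stuck: "\<And>x. B \<inter> shift x A \<noteq> {} \<Longrightarrow>
      fin_mean.mass I (B \<inter> shift x A) \<ge> fin_mean.mass I B - \<epsilon>"
    and c: "c > 0" "c \<le> fin_mean.mass I B" and \<epsilon>: "0 \<le> \<epsilon>" "\<epsilon> \<le> c / 2"
    and K: "1 < real (Suc K) * c"
  shows "fin_mean.mass I A * (1 - fin_mean.mass I A) \<le> fact K * (2 * \<epsilon> / c)"
proof -
  interpret invariant_mean I by (fact I)
  let ?\<tau> = "2 * \<epsilon> / c"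
  have \<tau>: "0 \<le> ?\<tau>" using c \<epsilon> by simp
  have multiple: "mass (A - shift (of_nat n * d) A) \<le> real n * mass (A - shift d A)" for n d
  proof (induction n)
    case 0
    then show ?case by (simp add: mass_empty)
  next
    case (Suc n)
    with mass_Diff_shift_add[of A d "of_nat n * d"] show ?case by (simp add: algebra_simps)
  qed
  have near: "mass (A - shift g A) \<le> fact K * ?\<tau>" for g
  proof -
    define h where "h = g / fact K"
    have "1 < real (Suc K) * mass B"
      using K c mult_left_mono[OF c(2), of "real (Suc K)"] by linarith
    from ex_multiple_in_differences[OF I this, of h]
    obtain n b b' where n: "1 \<le> n" "n \<le> K" "b \<in> B" "b' \<in> B" "of_nat n * h = b' - b" by blast
    have dvd: "n dvd fact K" using n by (simp add: dvd_fact)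
    then obtain q where q: "fact K = n * q" by blast
    have "g = fact K * h" by (simp add: h_def)
    also have "\<dots> = of_nat (fact K) * h" by simp
    also have "\<dots> = of_nat q * (of_nat n * h)" by (simp add: q)
    finally have g: "g = of_nat q * (b' - b)" by (simp add: n)
    have "q \<le> fact K" using n by (simp add: q)
    then have "real q \<le> fact K" by (metis of_nat_fact of_nat_le_iff)
    moreover have "mass (A - shift (b' - b) A) \<le> ?\<tau>"
      by (rule stuck_pair_almost_period[OF A stuck c \<epsilon> n(3,4)])
    ultimately have "real q * mass (A - shift (b' - b) A) \<le> fact K * ?\<tau>"
      using \<tau> by (intro mult_mono mass_nonneg) auto
    with multiple[of q "b' - b"] show ?thesis by (simp add: g)
  qed
  have "I (\<lambda>g. mass A - fact K * ?\<tau>) \<le> I (\<lambda>g. mass (A \<inter> shift g A))"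
  proof (rule mono)
    show "mass A - fact K * ?\<tau> \<le> mass (A \<inter> shift g A)" for g
      using near[of g] by (simp add: mass_Diff)
  qed (simp_all add: bounded_fun_mass)
  then show ?thesis by (simp add: const decorrelatedD[OF A] algebra_simps)
qed

text \<open>If the inequality fails, consider all pairs of sets in the family that have the same total mass as \<open>(A, B)\<close>, sums in \<open>C\<close>, and
a first component of mass at least that of \<open>A\<close>. The second components then have mass bounded below by
\<open>c = mass A + mass B - mass C\<close>, as \<open>C\<close> contains a translate of the first one. For a pair whose second component has
nearly minimal mass, a transform either makes it empty or lowers its mass by at most \<open>\<epsilon>\<close>, so \<open>stuck_pair_zero_one\<close>
applies; yet the first component has mass between \<open>mass A > 0\<close> and \<open>mass C < 1\<close>.\<close>

theorem mass_sumset_ge: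
  fixes I :: "(rat \<Rightarrow> real) \<Rightarrow> real"
  assumes I: "invariant_mean I"
    and decor: "\<And>X. X \<in> \<A> \<Longrightarrow> decorrelated I X"
    and Un: "\<And>X Y. X \<in> \<A> \<Longrightarrow> Y \<in> \<A> \<Longrightarrow> X \<union> Y \<in> \<A>"
    and Int: "\<And>X Y. X \<in> \<A> \<Longrightarrow> Y \<in> \<A> \<Longrightarrow> X \<inter> Y \<in> \<A>"
    and shift: "\<And>X t. X \<in> \<A> \<Longrightarrow> shift t X \<in> \<A>"
    and A: "A \<in> \<A>" "A \<noteq> {}" and B: "B \<in> \<A>" "B \<noteq> {}"
    and C: "\<And>a b. a \<in> A \<Longrightarrow> b \<in> B \<Longrightarrow> a + b \<in> C"
  shows "min 1 (fin_mean.mass I A + fin_mean.mass I B) \<le> fin_mean.mass I C"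
proof (rule ccontr)
  interpret invariant_mean I by (fact I)
  assume "\<not> ?thesis"
  then have less: "mass C < 1" "mass C < mass A + mass B" by auto
  have translate: "mass X \<le> mass C" if "\<And>x. x \<in> X \<Longrightarrow> x + t \<in> C" for X t
  proof -
    have "X \<subseteq> shift t C" using that by (auto simp: shift_def ac_simps)
    then show ?thesis using mass_mono[of X "shift t C"] by (simp add: mass_shift)
  qed
  obtain a where "a \<in> A" using A(2) by blast
  then have "mass B \<le> mass C"
    using C[of a] by (intro translate[of B a]) (simp add: add.commute)
  then have A_pos: "mass A > 0" using less by simp
  define c where "c = mass A + mass B - mass C"
  define \<kappa> where "\<kappa> = mass A * (1 - mass C)"
  have c: "c > 0" and \<kappa>: "\<kappa> > 0" using less A_pos by (auto simp: c_def \<kappa>_def)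
  obtain K where "1 / c < real K" using reals_Archimedean2 by blast
  then have K: "1 < real (Suc K) * c" using c by (simp add: field_simps)
  define P where "P = {(X, Y). X \<in> \<A> \<and> Y \<in> \<A> \<and> Y \<noteq> {} \<and> (\<forall>x\<in>X. \<forall>y\<in>Y. x + y \<in> C) \<and>
     mass X + mass Y = mass A + mass B \<and> mass A \<le> mass X}"
  define \<beta> where "\<beta> = Inf ((\<lambda>(X, Y). mass Y) ` P)"
  have bdd: "bdd_below ((\<lambda>(X, Y). mass Y) ` P)"
    by (rule bdd_belowI2[of _ 0]) (auto simp: mass_nonneg)
  have \<beta>_le: "\<beta> \<le> mass Y" if "(X, Y) \<in> P" for X Y
    unfolding \<beta>_def by (rule cInf_lower[OF _ bdd]) (use that in \<open>auto intro: rev_image_eqI\<close>)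
  \<comment> \<open>small enough that the bound of \<open>stuck_pair_zero_one\<close> is at most \<open>\<kappa> / 2\<close>\<close>
  define \<epsilon> where "\<epsilon> = min (c / 2) (\<kappa> * c / (4 * fact K))"
  have \<epsilon>: "0 < \<epsilon>" "\<epsilon> \<le> c / 2" "\<epsilon> \<le> \<kappa> * c / (4 * fact K)" using c \<kappa> by (auto simp: \<epsilon>_def)
  have "(A, B) \<in> P" using A B C by (auto simp: P_def)
  then have "(\<lambda>(X, Y). mass Y) ` P \<noteq> {}" by blast
  moreover have "Inf ((\<lambda>(X, Y). mass Y) ` P) < \<beta> + \<epsilon>" using \<epsilon> by (simp add: \<beta>_def)
  ultimately have "\<exists>z\<in>(\<lambda>(X, Y). mass Y) ` P. z < \<beta> + \<epsilon>" by (rule cInf_lessD)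
  then obtain X Y where XY: "(X, Y) \<in> P" "mass Y < \<beta> + \<epsilon>" by auto
  then have X: "X \<in> \<A>" "mass A \<le> mass X" and Y: "Y \<in> \<A>" "Y \<noteq> {}"
    and sum: "\<And>x y. x \<in> X \<Longrightarrow> y \<in> Y \<Longrightarrow> x + y \<in> C" "mass X + mass Y = mass A + mass B"
    by (auto simp: P_def)
  obtain y where "y \<in> Y" using Y(2) by blast
  then have XC: "mass X \<le> mass C" using sum(1)[of _ y] by (intro translate[of X y]) simp
  have stuck: "mass Y - \<epsilon> \<le> mass (Y \<inter> shift x X)" if ne: "Y \<inter> shift x X \<noteq> {}" for x
  proof -
    have "shift x X \<inter> shift x (shift (- x) Y) = shift x X \<inter> Y" by (simp add: shift_shift)
    then have "mass (X \<inter> shift (- x) Y) = mass (Y \<inter> shift x X)"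
      using mass_shift[of x "X \<inter> shift (- x) Y"] by (simp add: shift_Int Int_commute)
    then have mass: "mass (X \<union> shift (- x) Y) = mass X + mass Y - mass (Y \<inter> shift x X)"
      using mass_Un_Int[of X "shift (- x) Y"] by (simp add: mass_shift)
    have "u + v \<in> C" if "u \<in> X \<union> shift (- x) Y" "v \<in> Y \<inter> shift x X" for u v
    proof (cases "u \<in> X")
      case False
      then have "x + v \<in> X" "- x + u \<in> Y" using that by (auto simp: shift_def)
      then have "(x + v) + (- x + u) \<in> C" by (rule sum(1))
      then show ?thesis by (simp add: ac_simps)
    qed (use that sum(1) in auto)
    moreover have "mass X \<le> mass (X \<union> shift (- x) Y)" by (rule mass_mono) auto
    ultimately have "(X \<union> shift (- x) Y, Y \<inter> shift x X) \<in> P"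
      using X Y ne mass sum(2) Un Int shift by (auto simp: P_def)
    from \<beta>_le[OF this] show ?thesis using XY(2) by simp
  qed
  have "c \<le> mass Y" using XC sum(2) by (simp add: c_def)
  from stuck_pair_zero_one[OF I decor[OF X(1)] stuck c(1) this less_imp_le[OF \<epsilon>(1)] \<epsilon>(2) K]
  have "mass X * (1 - mass X) \<le> fact K * (2 * \<epsilon> / c)" .
  also have "\<dots> \<le> \<kappa> / 2" using \<epsilon>(3) c by (simp add: field_simps)
  also have "\<dots> < \<kappa>" using \<kappa> by simp
  also have "\<kappa> \<le> mass X * (1 - mass X)"
    unfolding \<kappa>_def using X(2) XC less A_pos by (intro mult_mono) auto
  finally show False by simp
qed

section \<open>The mass of a sum-free set of rationals\<close>

text \<open>Codes for the sets obtained from a sequence of sets by shifts, unions and intersections; they witness that this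
family, on which a decorrelating mean is needed, is countable.\<close>

datatype set_expr = Base nat | Shift rat set_expr | Join set_expr set_expr | Meet set_expr set_expr

instance set_expr :: countable
  by countable_datatype

primrec eval_expr :: "(nat \<Rightarrow> rat set) \<Rightarrow> set_expr \<Rightarrow> rat set" where
  "eval_expr \<B> (Base n) = \<B> n"
| "eval_expr \<B> (Shift t e) = shift t (eval_expr \<B> e)"
| "eval_expr \<B> (Join e f) = eval_expr \<B> e \<union> eval_expr \<B> f"
| "eval_expr \<B> (Meet e f) = eval_expr \<B> e \<inter> eval_expr \<B> f"

definition sums_of :: "nat \<Rightarrow> 'g::ab_group_add set \<Rightarrow> 'g set" where
  "sums_of n A = {\<Sum>i<n. a i | a. \<forall>i<n. a i \<in> A}"

lemma k_sum_free_iff: "k_sum_free k A \<longleftrightarrow> sums_of k A \<inter> A = {}"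
  by (auto simp: k_sum_free_def sums_of_def)

lemma sums_of_Suc:
  assumes "x \<in> sums_of n A" "y \<in> A" shows "x + y \<in> sums_of (Suc n) A"
proof -
  obtain a where a: "x = (\<Sum>i<n. a i)" "\<forall>i<n. a i \<in> A"
    using assms(1) by (auto simp: sums_of_def)
  have "x + y = (\<Sum>i<Suc n. (a(n := y)) i)" by (simp add: a(1))
  moreover have "\<forall>i<Suc n. (a(n := y)) i \<in> A" using a(2) assms(2) by simp
  ultimately show ?thesis unfolding sums_of_def by blast
qed

lemma sums_of_1: "sums_of (Suc 0) A = A"
  by (auto simp: sums_of_def intro: exI[of _ "\<lambda>_. _"])

lemma sums_of_nonempty: "A \<noteq> {} \<Longrightarrow> sums_of n A \<noteq> {}"
  by (auto simp: sums_of_def)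

text \<open>After passing to a mean that decorrelates all sets generated by the iterated sumsets of \<open>A\<close>, the sumset inequality
shows by induction that the \<open>n\<close>-fold sumset has mass at least \<open>min 1 (n * mass A)\<close>. The \<open>k\<close>-fold
sumset is disjoint from \<open>A\<close>, so its mass is at most \<open>1 - mass A\<close>.\<close>

theorem mass_k_sum_free_le:
  fixes A :: "rat set" and I0 :: "(rat \<Rightarrow> real) \<Rightarrow> real"
  assumes free: "k_sum_free k A" and k: "k \<ge> 1" and I0: "invariant_mean I0"
  shows "I0 (indicator A) \<le> 1 / (real k + 1)"
proof (rule ccontr)
  assume "\<not> ?thesis"
  then have big: "1 / (real k + 1) < I0 (indicator A)" by simp
  let ?e = "eval_expr (\<lambda>n. sums_of n A)"
  \<comment> \<open>\<open>A\<close> itself comes first, so that its mass stays above \<open>1 / (k + 1)\<close>\<close>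
  define S where "S = case_nat A (\<lambda>j. ?e (from_nat j))"
  obtain I where I: "invariant_mean I" "1 / (real k + 1) < I (indicator A)"
      "\<And>j. decorrelated I (S j)"
    using ex_decorrelated_mean[OF I0, of "1 / (real k + 1)" S] big by (auto simp: S_def)
  interpret invariant_mean I by (fact I)
  have decor: "decorrelated I (?e e)" for e
    using I(3)[of "Suc (to_nat e)"] by (simp add: S_def)
  have A: "1 / (real k + 1) < mass A" using I(2) by (simp add: mass_def)
  moreover have "0 < 1 / (real k + 1)" by simp
  ultimately have "A \<noteq> {}" using mass_empty by force
  have A_in: "A \<in> range ?e"
    by (rule range_eqI[of _ _ "Base (Suc 0)"]) (simp add: sums_of_1)
  have sums_in: "sums_of n A \<in> range ?e" for n
    by (rule range_eqI[of _ _ "Base n"]) simp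
  have step: "min 1 (mass (sums_of n A) + mass A) \<le> mass (sums_of (Suc n) A)" for n
  proof (rule mass_sumset_ge[OF I(1), of "range ?e"])
    fix X Y t assume "X \<in> range ?e"
    then obtain e where e: "X = ?e e" by blast
    show "decorrelated I X" using decor e by simp
    show "shift t X \<in> range ?e" by (rule range_eqI[of _ _ "Shift t e"]) (simp add: e)
    assume "Y \<in> range ?e"
    then obtain f where f: "Y = ?e f" by blast
    show "X \<union> Y \<in> range ?e" by (rule range_eqI[of _ _ "Join e f"]) (simp add: e f)
    show "X \<inter> Y \<in> range ?e" by (rule range_eqI[of _ _ "Meet e f"]) (simp add: e f)
  qed (use A_in sums_in \<open>A \<noteq> {}\<close> sums_of_nonempty[OF \<open>A \<noteq> {}\<close>] sums_of_Suc in blast)+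
  have "min 1 (real (Suc n) * mass A) \<le> mass (sums_of (Suc n) A)" for n
  proof (induction n)
    case 0
    then show ?case by (simp add: sums_of_1)
  next
    case (Suc n)
    with step[of "Suc n"] mass_nonneg[of A] show ?case by (auto simp: algebra_simps min_def split: if_splits)
  qed
  from this[of "k - 1"] have "min 1 (real k * mass A) \<le> mass (sums_of k A)" using k by simp
  also have "\<dots> \<le> 1 - mass A"
    using mass_disjoint_Un[of "sums_of k A" A] mass_le_1[of "sums_of k A \<union> A"] free
    by (simp add: k_sum_free_iff)
  finally have "min 1 (real k * mass A) \<le> 1 - mass A" .
  moreover have "1 < (real k + 1) * mass A" using A by (simp add: field_simps)
  moreover have "0 < mass A" using A by (rule less_trans[rotated]) simp
  ultimately show False by (auto simp: algebra_simps min_def split: if_splits)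
qed

text \<open>An additive Folner sequence of the rationals: the step \<open>1 / r!\<close> divides any given rational once \<open>r\<close> is large, and the
length \<open>r\<close> tends to infinity.\<close>

definition window :: "nat \<Rightarrow> rat set" where
  "window r = (\<lambda>j. of_nat j / fact r) ` {1..r * fact r}"

lemma finite_window [simp]: "finite (window r)"
  by (simp add: window_def)

lemma inj_window: "inj_on (\<lambda>j::nat. of_nat j / fact r :: rat) X"
  by (auto simp: inj_on_def)

lemma card_window: "card (window r) = r * fact r"
  by (simp add: window_def card_image inj_window)

lemma window_pos: "q \<in> window r \<Longrightarrow> q > 0"
  by (auto simp: window_def)

text \<open>Moving a window by one step changes the sum by two values of \<open>f\<close> only.\<close>

lemma window_translate_bound:
  fixes f :: "rat \<Rightarrow> real"
  assumes M: "\<And>x. \<bar>f x\<bar> \<le> M"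
  shows "\<bar>(\<Sum>x\<in>window r. f (of_nat s / fact r + x)) - (\<Sum>x\<in>window r. f x)\<bar> \<le> 2 * M * real s"
proof -
  define g where "g = (\<lambda>j. f (of_nat j / fact r))"
  define N :: nat where "N = r * fact r"
  have "(\<Sum>x\<in>window r. f (of_nat s / fact r + x)) = (\<Sum>j=1..N. g (s + j))" for s
    unfolding window_def N_def g_def
    by (subst sum.reindex[OF inj_window]) (simp add: add_divide_distrib)
  note sum_eq = this this[of 0]
  have step: "\<bar>(\<Sum>j=1..N. g (Suc s + j)) - (\<Sum>j=1..N. g (s + j))\<bar> \<le> 2 * M" for s
  proof -
    have "(\<Sum>j=1..N. g (Suc s + j)) - (\<Sum>j=1..N. g (s + j)) = g (Suc s + N) - g (Suc s)"
      by (induction N) auto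
    then show ?thesis using M[of "of_nat (Suc s + N) / fact r"] M[of "of_nat (Suc s) / fact r"]
      unfolding g_def by linarith
  qed
  have "\<bar>(\<Sum>j=1..N. g (s + j)) - (\<Sum>j=1..N. g (0 + j))\<bar> \<le> 2 * M * real s"
  proof (induction s)
    case (Suc s)
    with step[of s] show ?case by (simp add: algebra_simps)
  qed simp
  then show ?thesis using sum_eq by simp
qed

lemma nonneg_rat_as_fraction:
  fixes t :: rat
  assumes "t \<ge> 0"
  shows "\<exists>a b. t = of_nat a / of_nat b \<and> b > 0"
proof -
  obtain p q where pq: "quotient_of t = (p, q)" by fastforce
  have q: "q > 0" "t = of_int p / of_int q"
    using quotient_of_denom_pos[OF pq] quotient_of_div[OF pq] by auto
  then have "p \<ge> 0" using assms by (simp add: zero_le_divide_iff)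
  then have "t = of_nat (nat p) / of_nat (nat q)" "nat q > 0" using q by auto
  then show ?thesis by blast
qed

lemma fin_mean_window:
  assumes "r > 0"
  shows "fin_mean (\<lambda>f. (\<Sum>x\<in>window r. f x) / real (card (window r)))"
proof -
  have "card (window r) \<noteq> 0" using assms by (simp add: card_window)
  then have "window r \<noteq> {}" by auto
  then show ?thesis using fin_mean_average[of "window r" "\<lambda>x. x"] by simp
qed

text \<open>A translation by \<open>t = a / b\<close> amounts to \<open>t * r!\<close> steps as soon as \<open>b\<close> divides \<open>r!\<close>. It changes the average over the
\<open>r * r!\<close> points of the window by \<open>O(t / r)\<close>. Negative translations follow by reversal.\<close>

lemma invariant_mean_windows:
  assumes r: "\<And>i. i < r i"
  shows "invariant_mean (\<lambda>f. glim (\<lambda>i. (\<Sum>x\<in>window (r i). f x) / real (card (window (r i)))))"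
    (is "invariant_mean (\<lambda>f. glim (\<lambda>i. ?J i f))")
proof -
  have J: "fin_mean (?J i)" for i
    by (rule fin_mean_window) (use r[of i] in simp)
  note lim = fin_mean_glim(2)[where J = ?J, OF J]
  interpret L: fin_mean "\<lambda>f. glim (\<lambda>i. ?J i f)" using J by (rule fin_mean_glim)
  have pos: "glim (\<lambda>i. ?J i (\<lambda>x. f (t + x))) = glim (\<lambda>i. ?J i f)"
    if f: "bounded_fun f" and t: "t \<ge> 0" for f t
  proof -
    obtain M where M: "\<And>x. \<bar>f x\<bar> \<le> M" using f by (auto simp: bounded_fun_def)
    obtain a b where ab: "t = of_nat a / of_nat b" "b > 0"
      using nonneg_rat_as_fraction[OF t] by blast
    have bound: "\<bar>?J i (\<lambda>x. f (t + x)) - ?J i f\<bar> \<le> 2 * M * real a / real (Suc i)" if "i \<ge> b" for i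
    proof -
      have "b dvd fact (r i)" using that r[of i] ab(2) by (intro dvd_fact) auto
      then obtain c where c: "fact (r i) = b * c" by blast
      have c_pos: "c > 0" using c by (metis fact_nonzero gr0I mult_0_right)
      define s where "s = a * c"
      have "(of_nat s / of_nat (fact (r i)) :: rat) = t"
        unfolding c s_def using ab c_pos by simp
      then have s: "of_nat s / fact (r i) = t" by simp
      have "\<bar>?J i (\<lambda>x. f (t + x)) - ?J i f\<bar>
          = \<bar>(\<Sum>x\<in>window (r i). f (t + x)) - (\<Sum>x\<in>window (r i). f x)\<bar> / real (r i * fact (r i))"
        by (simp add: card_window diff_divide_distrib[symmetric] abs_divide)
      also have "\<dots> \<le> 2 * M * real s / real (r i * fact (r i))"
        using window_translate_bound[where f = f and M = M and r = "r i" and s = s, OF M] by (intro divide_right_mono) (auto simp: s)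
      also have "\<dots> = 2 * M * real a / (real (r i) * real b)"
      proof -
        have "real (r i * fact (r i)) = real (r i) * (real b * real c)"
          by (metis c of_nat_mult)
        then show ?thesis unfolding s_def using c_pos by (simp only: of_nat_mult) simp
      qed
      also have "\<dots> \<le> 2 * M * real a / real (Suc i)"
      proof (rule divide_left_mono)
        have "Suc i * 1 \<le> r i * b" using r[of i] ab(2) by (intro mult_le_mono) auto
        then show "real (Suc i) \<le> real (r i) * real b" by (metis mult_1_right of_nat_le_iff of_nat_mult)
        show "0 \<le> 2 * M * real a" using M[of 0] by simp
        show "0 < real (r i) * real b * real (Suc i)" using r[of i] ab(2) by simp
      qed
      finally show ?thesis .
    qed
    have "(\<lambda>i. ?J i (\<lambda>x. f (t + x)) - ?J i f) \<longlonglongrightarrow> 0"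
    proof (rule Lim_null_comparison)
      show "\<forall>\<^sub>F i in sequentially. norm (?J i (\<lambda>x. f (t + x)) - ?J i f) \<le> 2 * M * real a / real (Suc i)"
        using eventually_ge_at_top[of b] by eventually_elim (use bound in simp)
      show "(\<lambda>i. 2 * M * real a / real (Suc i)) \<longlonglongrightarrow> 0"
        by (rule LIMSEQ_Suc[OF lim_const_over_n])
    qed
    then have "((\<lambda>i. ?J i (\<lambda>x. f (t + x)) - ?J i f) \<longlongrightarrow> 0) universal_filter"
      by (rule tendsto_universal_filter)
    moreover have "((\<lambda>i. ?J i (\<lambda>x. f (t + x)) - ?J i f)
        \<longlongrightarrow> glim (\<lambda>i. ?J i (\<lambda>x. f (t + x))) - glim (\<lambda>i. ?J i f)) universal_filter"
      using f by (intro tendsto_diff lim) simp_all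
    ultimately have "0 = glim (\<lambda>i. ?J i (\<lambda>x. f (t + x))) - glim (\<lambda>i. ?J i f)"
      by (rule tendsto_unique[OF universal_filter_nontrivial])
    then show ?thesis by simp
  qed
  show ?thesis
  proof unfold_locales
    fix f :: "rat \<Rightarrow> real" and t assume f: "bounded_fun f"
    show "glim (\<lambda>i. ?J i (\<lambda>x. f (t + x))) = glim (\<lambda>i. ?J i f)"
    proof (cases "t \<ge> 0")
      case True
      then show ?thesis using pos f by blast
    next
      case False
      then have "glim (\<lambda>i. ?J i (\<lambda>x. f (t + (- t + x)))) = glim (\<lambda>i. ?J i (\<lambda>x. f (t + x)))"
        using f by (intro pos) auto
      then show ?thesis by simp
    qed
  qed
qed

text \<open>Otherwise the averages over a sequence of windows in which \<open>A\<close> is dense would have an invariant mean giving \<open>A\<close> mass at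
least \<open>d\<close> as a universal limit.\<close>

lemma k_sum_free_windows_eventually_sparse:
  assumes free: "k_sum_free k A" and k: "k \<ge> 1" and d: "1 / (real k + 1) < d"
  shows "\<exists>n. \<forall>r>n. real (card (A \<inter> window r)) < d * real (card (window r))"
proof (rule ccontr)
  assume neg: "\<not> ?thesis"
  then have "\<forall>n. \<exists>r>n. d * real (card (window r)) \<le> real (card (A \<inter> window r))"
    by (simp add: not_less)
  then obtain r where r: "\<And>n. n < r n"
    "\<And>n. d * real (card (window (r n))) \<le> real (card (A \<inter> window (r n)))" by metis
  let ?J = "\<lambda>i f. (\<Sum>x\<in>window (r i). f x) / real (card (window (r i)))"
  let ?I = "\<lambda>f. glim (\<lambda>i. ?J i f)"
  have J: "d \<le> ?J i (indicator A)" for i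
  proof -
    have "(\<Sum>x\<in>window (r i). indicat_real A x) = real (card (A \<inter> window (r i)))"
      by (simp add: indicator_def Int_commute flip: of_bool_def)
    moreover have "card (window (r i)) > 0" using r(1)[of i] by (simp add: card_window)
    ultimately show ?thesis using r(2)[of i] by (simp add: field_simps)
  qed
  have "fin_mean (?J i)" for i
    by (rule fin_mean_window) (use r(1)[of i] in simp)
  then have "((\<lambda>i. ?J i (indicator A)) \<longlongrightarrow> ?I (indicator A)) universal_filter"
    by (rule fin_mean_glim(2)) simp
  then have "d \<le> ?I (indicator A)"
    by (rule tendsto_lowerbound) (use J in auto)
  also have "\<dots> \<le> 1 / (real k + 1)"
    by (rule mass_k_sum_free_le[OF free k invariant_mean_windows[OF r(1)]])
  finally show False using d by simp
qed

section \<open>Dilating sets of integers into the rationals\<close>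

lemma (in fin_mean) mass_UN_le: "finite E \<Longrightarrow> mass (\<Union>i\<in>E. X i) \<le> (\<Sum>i\<in>E. mass (X i))"
proof (induction E rule: finite_induct)
  case (insert i E)
  with mass_Un_le[of "X i" "\<Union>i\<in>E. X i"] show ?case by simp
qed (simp add: mass_empty)

text \<open>For a countably additive probability, Fatou's lemma would produce a point that lies in infinitely many \<open>E r\<close>. With finite
additivity one still gets blocks of indices such that any finite number of them can be hit by one point. The next block
\<open>{s i..<s (Suc i)}\<close> is chosen so long that the union of its events has almost the supremum \<open>v (s i)\<close> of the masses
of all finite unions of events from \<open>s i\<close> on. Any later block then adds at most \<open>\<epsilon> / 2 ^ (i + 2)\<close> to it, so the last of
the unions meets all the earlier ones in mass at least \<open>\<epsilon> / 2\<close>.\<close>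

lemma (in fin_mean) ex_hitting_blocks:
  fixes E :: "nat \<Rightarrow> 'g set"
  assumes \<epsilon>: "\<epsilon> > 0" "\<And>r. \<epsilon> \<le> mass (E r)"
  shows "\<exists>s::nat \<Rightarrow> nat. strict_mono s \<and> (\<forall>j. \<exists>\<omega>. \<forall>i\<le>j. \<exists>r\<in>{s i..<s (Suc i)}. \<omega> \<in> E r)"
proof -
  define U where "U s t = (\<Union>r\<in>{s..<t}. E r)" for s t
  define v where "v s = (SUP t. mass (U s t))" for s
  have bdd: "bdd_above (range (\<lambda>t. mass (U s t)))" for s
    using mass_le_1 by (intro bdd_aboveI2)
  have U_le: "mass (U s t) \<le> v s" for s t
    unfolding v_def by (intro cSUP_upper bdd) simp
  have v_ge: "\<epsilon> \<le> v s" for s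
    using \<epsilon>(2)[of s] U_le[of s "Suc s"] by (simp add: U_def)
  have ex: "\<exists>t>s. v s - \<epsilon> * (1/2) ^ (i + 2) < mass (U s t)" for s i
  proof -
    have "v s - \<epsilon> * (1/2) ^ (i + 2) < v s" using \<epsilon> by simp
    then obtain t where t: "v s - \<epsilon> * (1/2) ^ (i + 2) < mass (U s t)"
      unfolding v_def using less_cSUP_iff[OF UNIV_not_empty bdd[of s]] by blast
    moreover have "mass (U s t) \<le> mass (U s (max t (Suc s)))"
      by (rule mass_mono) (auto simp: U_def)
    ultimately show ?thesis by (intro exI[of _ "max t (Suc s)"]) auto
  qed
  have "\<exists>s. \<forall>n. True \<and> (s n < s (Suc n) \<and> v (s n) - \<epsilon> * (1/2) ^ (n + 2) < mass (U (s n) (s (Suc n))))"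
    by (rule dependent_nat_choice) (use ex in auto)
  then obtain s where s: "\<And>n. s n < s (Suc n)"
    "\<And>n. v (s n) - \<epsilon> * (1/2) ^ (n + 2) < mass (U (s n) (s (Suc n)))" by blast
  have mono: "strict_mono s" using s(1) by (simp add: strict_mono_Suc_iff)
  define V where "V i = U (s i) (s (Suc i))" for i
  have V_diff: "mass (V j - V i) \<le> \<epsilon> * (1/2) ^ (i + 2)" if "i < j" for i j
  proof -
    have "s i \<le> s j" "s (Suc i) \<le> s (Suc j)" using that mono by (simp_all add: strict_mono_less_eq)
    then have "V j \<subseteq> U (s i) (s (Suc j))" "V i \<subseteq> U (s i) (s (Suc j))"
      unfolding V_def U_def by (intro UN_mono; force)+
    then have "(V j - V i) \<union> V i \<subseteq> U (s i) (s (Suc j))" by blast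
    then have "mass ((V j - V i) \<union> V i) \<le> v (s i)"
      using mass_mono U_le order_trans by blast
    moreover have "mass ((V j - V i) \<union> V i) = mass (V j - V i) + mass (V i)"
      by (rule mass_disjoint_Un) auto
    ultimately show ?thesis using s(2)[of i] by (simp add: V_def)
  qed
  have "\<exists>\<omega>. \<forall>i\<le>j. \<exists>r\<in>{s i..<s (Suc i)}. \<omega> \<in> E r" for j
  proof -
    have "V j \<subseteq> (\<Inter>i\<in>{..j}. V i) \<union> (\<Union>i\<in>{..<j}. V j - V i)"
      by (auto simp: le_less)
    then have "mass (V j) \<le> mass ((\<Inter>i\<in>{..j}. V i) \<union> (\<Union>i\<in>{..<j}. V j - V i))" by (rule mass_mono)
    also have "\<dots> \<le> mass (\<Inter>i\<in>{..j}. V i) + mass (\<Union>i\<in>{..<j}. V j - V i)" by (rule mass_Un_le)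
    also have "mass (\<Union>i\<in>{..<j}. V j - V i) \<le> (\<Sum>i<j. mass (V j - V i))" by (rule mass_UN_le) simp
    also have "\<dots> \<le> (\<Sum>i<j. \<epsilon> * (1/2) ^ (i + 2))" using V_diff by (intro sum_mono) auto
    also have "\<dots> = \<epsilon> * (1/2 - (1/2) ^ (j + 1))"
      by (induction j) (simp_all add: algebra_simps)
    finally have "mass (V j) \<le> mass (\<Inter>i\<in>{..j}. V i) + \<epsilon> * (1/2 - (1/2) ^ (j + 1))" by simp
    moreover have "\<epsilon> - \<epsilon> * (1/2) ^ (j + 2) < mass (V j)" using s(2)[of j] v_ge[of "s j"] by (simp add: V_def)
    ultimately have "\<epsilon> * (1/2 + (1/2) ^ (j + 2)) < mass (\<Inter>i\<in>{..j}. V i)" by (simp add: algebra_simps)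
    moreover have "0 \<le> \<epsilon> * (1/2 + (1/2) ^ (j + 2))" using \<epsilon> by simp
    ultimately have "mass (\<Inter>i\<in>{..j}. V i) \<noteq> 0" by linarith
    then have "(\<Inter>i\<in>{..j}. V i) \<noteq> {}" using mass_empty by metis
    then obtain \<omega> where "\<And>i. i \<le> j \<Longrightarrow> \<omega> \<in> V i" by auto
    then show ?thesis by (intro exI[of _ \<omega>]) (auto simp: V_def U_def)
  qed
  with mono show ?thesis by blast
qed

text \<open>The map \<open>s \<mapsto> b * s / a\<close> embeds into the set on the right those \<open>s \<in> S\<close> for which \<open>b * s\<close> lies in \<open>a \<cdot> F\<close>. For the other
\<open>s \<in> S\<close> the element \<open>b * s\<close> of \<open>b \<cdot> F\<close> is missing from \<open>a \<cdot> F\<close>. Depending on whether it belongs to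
\<open>F\<close>, it lies in the first or in the second symmetric difference.\<close>

lemma card_dilated_subset:
  fixes F S :: "nat set"
  assumes F: "finite F" and S: "S \<subseteq> F" and a: "a \<ge> 1" and b: "b \<ge> 1"
  shows "card S \<le> card {x \<in> F. \<exists>s\<in>S. b * s = a * x}
      + card (sym_diff ((\<lambda>x. a * x) ` F) F) + card (sym_diff ((\<lambda>x. b * x) ` F) F)"
proof -
  define S1 where "S1 = {s \<in> S. b * s \<in> (\<lambda>x. a * x) ` F}"
  define T where "T = {x \<in> F. \<exists>s\<in>S. b * s = a * x}"
  let ?D = "\<lambda>a. sym_diff ((\<lambda>x. a * x) ` F) F"
  have fin: "finite S" using F S finite_subset by blast
  have "card S1 \<le> card T"
  proof (rule card_inj_on_le)
    show "inj_on (\<lambda>s. b * s div a) S1"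
    proof (rule inj_onI)
      fix s t assume "s \<in> S1" "t \<in> S1" "b * s div a = b * t div a"
      moreover from this have "a dvd b * s" "a dvd b * t" by (auto simp: S1_def)
      ultimately have "b * s = b * t" by (metis dvd_mult_div_cancel)
      then show "s = t" using b by simp
    qed
    show "(\<lambda>s. b * s div a) ` S1 \<subseteq> T" using a by (auto simp: S1_def T_def)
    show "finite T" using F by (simp add: T_def)
  qed
  moreover have "card (S - S1) \<le> card (?D a \<union> ?D b)"
  proof (rule card_inj_on_le)
    show "inj_on (\<lambda>s. b * s) (S - S1)" using b by (auto simp: inj_on_def)
    show "(\<lambda>s. b * s) ` (S - S1) \<subseteq> ?D a \<union> ?D b" using S by (auto simp: S1_def)
    show "finite (?D a \<union> ?D b)" using F by simp
  qed
  moreover have "card (?D a \<union> ?D b) \<le> card (?D a) + card (?D b)" by (rule card_Un_le)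
  moreover have "card S = card S1 + card (S - S1)"
    using fin by (subst card_Un_disjoint[symmetric]) (auto simp: S1_def intro: arg_cong[of _ _ card])
  ultimately show ?thesis by (simp add: T_def)
qed

text \<open>The part of \<open>S / x\<close> in the positive rationals; the defining equation is kept free of division, so that it can be
multiplied out for \<open>x = 0\<close> as well.\<close>

definition rescaled :: "nat set \<Rightarrow> nat \<Rightarrow> rat set" where
  "rescaled S x = {q. q > 0 \<and> (\<exists>s\<in>S. of_nat s = q * of_nat x)}"

lemma k_sum_free_rescaled:
  assumes "k_sum_free k (int ` S)"
  shows "k_sum_free k (rescaled S x)"
  unfolding k_sum_free_def
proof (intro notI, elim exE conjE)
  fix a assume a: "\<forall>i<k. a i \<in> rescaled S x" "(\<Sum>i<k. a i) \<in> rescaled S x"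
  then have "\<forall>i. \<exists>s. i < k \<longrightarrow> s \<in> S \<and> of_nat s = a i * of_nat x" by (auto simp: rescaled_def)
  then obtain s where s: "\<And>i. i < k \<Longrightarrow> s i \<in> S" "\<And>i. i < k \<Longrightarrow> of_nat (s i) = a i * of_nat x" by metis
  obtain s' where s': "s' \<in> S" "of_nat s' = (\<Sum>i<k. a i) * of_nat x" using a(2) by (auto simp: rescaled_def)
  have "(of_nat s' :: rat) = of_nat (\<Sum>i<k. s i)" using s(2) by (simp add: s'(2) sum_distrib_right)
  then have "s' = (\<Sum>i<k. s i)" by (simp only: of_nat_eq_iff)
  then have "(\<Sum>i<k. int (s i)) = int s'" by simp
  then have "(\<Sum>i<k. int (s i)) \<in> int ` S" using s'(1) by (simp only: image_eqI)
  then have "(\<forall>i<k. (int \<circ> s) i \<in> int ` S) \<and> (\<Sum>i<k. (int \<circ> s) i) \<in> int ` S" using s(1) by simp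
  then have "\<exists>a. (\<forall>i<k. a i \<in> int ` S) \<and> (\<Sum>i<k. a i) \<in> int ` S" by (rule exI[of _ "int \<circ> s"])
  with assms show False unfolding k_sum_free_def by (rule notE)
qed

lemma mem_rescaled_iff:
  assumes "a \<ge> 1" "b \<ge> 1" "(q::rat) = of_nat a / of_nat b"
  shows "q \<in> rescaled S x \<longleftrightarrow> (\<exists>s\<in>S. b * s = a * x)"
proof -
  have "of_nat s = q * of_nat x \<longleftrightarrow> b * s = a * x" for s
  proof -
    have b: "(of_nat b :: rat) \<noteq> 0" "of_nat b * q = of_nat a" using assms by auto
    have "of_nat s = q * of_nat x \<longleftrightarrow> of_nat b * of_nat s = of_nat b * (q * of_nat x)"
      using b(1) by simp
    also have "\<dots> \<longleftrightarrow> (of_nat (b * s) :: rat) = of_nat (a * x)"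
      by (simp add: b(2) flip: mult.assoc)
    finally have "of_nat s = q * of_nat x \<longleftrightarrow> (of_nat (b * s) :: rat) = of_nat (a * x)" .
    then show ?thesis by (simp only: of_nat_eq_iff)
  qed
  moreover have "q > 0" using assms by simp
  ultimately show ?thesis by (simp add: rescaled_def)
qed

text \<open>The pointwise limit of the sets \<open>X j\<close> along the universal filter agrees with some late \<open>X j\<close> on any given finite set, and a
violation of sum-freeness involves only finitely many elements.\<close>

lemma ex_limit_set:
  fixes X :: "nat \<Rightarrow> 'a::ab_group_add set"
  assumes "\<And>j. k_sum_free k (X j)"
  obtains A where "k_sum_free k A"
    "\<And>W n. finite W \<Longrightarrow> \<exists>j\<ge>n. A \<inter> W = X j \<inter> W"
proof
  define A where "A = {q. eventually (\<lambda>j. q \<in> X j) universal_filter}"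
  have iff: "eventually (\<lambda>j. q \<in> A \<longleftrightarrow> q \<in> X j) universal_filter" for q
    using universal_filter_ultra[of "\<lambda>j. q \<in> X j"]
  proof
    assume ev: "eventually (\<lambda>j. q \<notin> X j) universal_filter"
    have "q \<notin> A"
    proof
      assume "q \<in> A"
      then have "eventually (\<lambda>j. q \<in> X j) universal_filter" by (simp add: A_def)
      with ev have "eventually (\<lambda>j. False) universal_filter" by eventually_elim simp
      then show False by simp
    qed
    with ev show ?thesis by (auto elim: eventually_mono)
  next
    assume ev: "eventually (\<lambda>j. q \<in> X j) universal_filter"
    then have "q \<in> A" by (simp add: A_def)
    with ev show ?thesis by (auto elim: eventually_mono)
  qed
  show agree: "\<exists>j\<ge>n. A \<inter> W = X j \<inter> W" if "finite W" for W n
  proof -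
    have "eventually (\<lambda>j. \<forall>q\<in>W. q \<in> A \<longleftrightarrow> q \<in> X j) universal_filter"
      using iff that by (intro eventually_ball_finite) auto
    moreover have "eventually (\<lambda>j. n \<le> j) universal_filter"
      by (rule eventually_universal_filter) (rule eventually_ge_at_top)
    ultimately have "eventually (\<lambda>j. n \<le> j \<and> A \<inter> W = X j \<inter> W) universal_filter"
      by eventually_elim auto
    then show ?thesis using eventually_happens'[OF universal_filter_nontrivial] by blast
  qed
  show "k_sum_free k A"
    unfolding k_sum_free_def
  proof (intro notI, elim exE conjE)
    fix a assume a: "\<forall>i<k. a i \<in> A" "(\<Sum>i<k. a i) \<in> A"
    obtain j where j: "A \<inter> insert (\<Sum>i<k. a i) (a ` {..<k}) = X j \<inter> insert (\<Sum>i<k. a i) (a ` {..<k})"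
      using agree[of "insert (\<Sum>i<k. a i) (a ` {..<k})" 0] by auto
    have "\<forall>i<k. a i \<in> X j" "(\<Sum>i<k. a i) \<in> X j" using a j by blast+
    then show False using assms[of j] unfolding k_sum_free_def by blast
  qed
qed

section \<open>Sum-free subsets of multiplicative Folner sets\<close>

theorem theorem1:
  fixes k :: nat and F :: "nat \<Rightarrow> nat set"
  assumes "k \<ge> 2" and "mult_folner_seq F"
  shows "\<forall>\<eta>::real. \<eta> > 0 \<longrightarrow>
           (\<exists>M\<ge>1. \<forall>m\<ge>M. \<forall>S. S \<subseteq> F m \<and> k_sum_free k (int ` S) \<longrightarrow>
              real (card S) \<le> (1 / (real k + 1) + \<eta>) * real (card (F m)))"
proof (intro allI impI, rule ccontr)
  fix \<eta> :: real assume \<eta>: "\<eta> > 0"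
  define \<delta> where "\<delta> = 1 / (real k + 1) + \<eta>"
  assume neg: "\<not> (\<exists>M\<ge>1. \<forall>m\<ge>M. \<forall>S. S \<subseteq> F m \<and> k_sum_free k (int ` S) \<longrightarrow>
              real (card S) \<le> (1 / (real k + 1) + \<eta>) * real (card (F m)))"
  have "\<exists>m S. Suc i \<le> m \<and> S \<subseteq> F m \<and> k_sum_free k (int ` S) \<and> \<delta> * real (card (F m)) < real (card S)" for i
    using neg[unfolded not_ex, rule_format, of "Suc i"] by (auto simp: \<delta>_def not_le)
  then obtain m S where m: "\<And>i. Suc i \<le> m i" and S: "\<And>i. S i \<subseteq> F (m i)" "\<And>i. k_sum_free k (int ` S i)"
    "\<And>i. \<delta> * real (card (F (m i))) < real (card (S i))" by metis
  have m_lim: "filterlim m at_top sequentially"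
    by (rule filterlim_at_top_mono[OF filterlim_Suc]) (use m in auto)
  have F: "finite (F (m i))" "F (m i) \<noteq> {}" for i
    using assms(2) m[of i] by (auto simp: mult_folner_seq_def)
  define ratio where "ratio a i = real (card (sym_diff ((\<lambda>x. a * x) ` F (m i)) (F (m i)))) / real (card (F (m i)))" for a i
  have ratio: "ratio a \<longlonglongrightarrow> 0" if "a \<ge> 1" for a
    using assms(2) that filterlim_compose[OF _ m_lim]
    unfolding mult_folner_seq_def ratio_def by blast
  define J where "J i f = (\<Sum>x\<in>F (m i). f (i, x)) / real (card (F (m i)))" for i and f :: "nat \<times> nat \<Rightarrow> real"
  have J: "fin_mean (J i)" for i
    unfolding J_def by (rule fin_mean_average[OF F])
  \<comment> \<open>a random pair \<open>(i, x)\<close>: \<open>x\<close> is uniform in \<open>F (m i)\<close>, and \<open>i\<close> tends to infinity\<close>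
  define \<Lambda> where "\<Lambda> f = glim (\<lambda>i. J i f)" for f
  interpret \<Lambda>: fin_mean \<Lambda>
    unfolding \<Lambda>_def by (rule fin_mean_glim(1)[OF J])
  define E where "E q = {(i, x). q \<in> rescaled (S i) x}" for q
  have E_mass: "\<delta> \<le> \<Lambda>.mass (E q)" if q: "q > 0" for q
  proof -
    obtain a b where ab: "a \<ge> 1" "b \<ge> 1" "q = of_nat a / of_nat b"
    proof -
      from nonneg_rat_as_fraction[of q] q
      obtain a b where "q = of_nat a / of_nat b" "b > 0" by auto
      moreover from this q have "a > 0" by (cases a) auto
      ultimately show ?thesis using that[of a b] by simp
    qed
    have "\<delta> - ratio a i - ratio b i \<le> J i (indicator (E q))" for i
    proof -
      have N: "real (card (F (m i))) > 0" using F by (simp add: card_gt_0_iff)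
      have "(\<Sum>x\<in>F (m i). indicat_real (E q) (i, x)) = real (card {x \<in> F (m i). \<exists>s\<in>S i. b * s = a * x})"
        using F by (simp add: E_def indicator_def mem_rescaled_iff[OF ab] Int_def conj_commute flip: of_bool_def)
      moreover have "\<delta> * real (card (F (m i))) \<le> real (card {x \<in> F (m i). \<exists>s\<in>S i. b * s = a * x})
         + ratio a i * real (card (F (m i))) + ratio b i * real (card (F (m i)))"
        using card_dilated_subset[OF F(1) S(1) ab(1,2), of i] S(3)[of i] N unfolding ratio_def
        by (simp del: of_nat_add add: of_nat_add[symmetric])
      ultimately show ?thesis using N by (simp add: J_def field_simps)
    qed
    moreover have "((\<lambda>i. \<delta> - ratio a i - ratio b i) \<longlongrightarrow> \<delta> - 0 - 0) universal_filter"
      by (intro tendsto_diff tendsto_const tendsto_universal_filter ratio ab)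
    moreover have "((\<lambda>i. J i (indicator (E q))) \<longlongrightarrow> \<Lambda> (indicator (E q))) universal_filter"
      unfolding \<Lambda>_def by (rule fin_mean_glim(2)[OF J]) simp
    ultimately have "\<delta> - 0 - 0 \<le> \<Lambda> (indicator (E q))"
      using tendsto_le[OF universal_filter_nontrivial] always_eventually by blast
    then show ?thesis by (simp add: \<Lambda>.mass_def)
  qed
  define d where "d = 1 / (real k + 1) + \<eta> / 2"
  define A where "A = (\<lambda>(i, x). rescaled (S i) x)"
  \<comment> \<open>\<open>window 0\<close> is empty, hence the \<open>Suc\<close>\<close>
  define G where "G r = {\<omega>. d * real (card (window (Suc r))) \<le> real (card (A \<omega> \<inter> window (Suc r)))}" for r
  \<comment> \<open>Markov: the expected density in the window is at least \<open>\<delta> = d + \<eta> / 2\<close>, while the density is at most \<open>1\<close> on \<open>G r\<close> and at most \<open>d\<close> elsewhere\<close>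
  have G_mass: "\<eta> / 2 \<le> \<Lambda>.mass (G r)" for r
  proof -
    define N where "N = real (card (window (Suc r)))"
    have N: "N > 0" by (simp add: N_def card_window del: fact_Suc of_nat_Suc mult_Suc)
    have count: "(\<Sum>q\<in>window (Suc r). indicat_real (E q) \<omega>) = real (card (A \<omega> \<inter> window (Suc r)))" for \<omega>
    proof -
      have "indicat_real (E q) \<omega> = of_bool (q \<in> A \<omega>)" for q
        by (cases \<omega>) (simp add: E_def A_def indicator_def)
      then have "(\<Sum>q\<in>window (Suc r). indicat_real (E q) \<omega>) = (\<Sum>q\<in>window (Suc r). of_bool (q \<in> A \<omega>))"
        by (simp only:)
      then show ?thesis by (simp add: Int_commute)
    qed
    have "N * \<delta> = (\<Sum>q\<in>window (Suc r). \<delta>)" by (simp add: N_def)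
    also have "\<dots> \<le> (\<Sum>q\<in>window (Suc r). \<Lambda>.mass (E q))"
      by (intro sum_mono E_mass) (rule window_pos)
    also have "\<dots> = \<Lambda> (\<lambda>\<omega>. \<Sum>q\<in>window (Suc r). indicat_real (E q) \<omega>)"
      unfolding \<Lambda>.mass_def by (rule \<Lambda>.sum[symmetric]) simp
    also have "\<dots> \<le> \<Lambda> (\<lambda>\<omega>. d * N + N * indicator (G r) \<omega>)"
    proof (rule \<Lambda>.mono)
      fix \<omega>
      have le: "real (card (A \<omega> \<inter> window (Suc r))) \<le> N"
        unfolding N_def of_nat_le_iff by (rule card_mono) auto
      show "(\<Sum>q\<in>window (Suc r). indicat_real (E q) \<omega>) \<le> d * N + N * indicator (G r) \<omega>"
      proof (cases "\<omega> \<in> G r")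
        case True
        have "0 \<le> d * N" using N \<eta> by (simp add: d_def)
        then show ?thesis unfolding count using True le by simp
      next
        case False
        then show ?thesis unfolding count by (simp add: G_def N_def)
      qed
    qed simp_all
    also have "\<dots> = d * N + N * \<Lambda>.mass (G r)"
      using \<Lambda>.add[of "\<lambda>_. d * N" "\<lambda>\<omega>. N * indicator (G r) \<omega>"] \<Lambda>.const[of "d * N"]
        \<Lambda>.scale[of "indicator (G r)" N] by (simp add: \<Lambda>.mass_def)
    finally have "N * (\<eta> / 2) \<le> N * \<Lambda>.mass (G r)" by (simp add: \<delta>_def d_def algebra_simps)
    then show ?thesis using N by simp
  qed
  have "\<eta> / 2 > 0" using \<eta> by simp
  from \<Lambda>.ex_hitting_blocks[OF this G_mass]
  obtain s where "strict_mono s \<and> (\<forall>j. \<exists>\<omega>. \<forall>i\<le>j. \<exists>r\<in>{s i..<s (Suc i)}. \<omega> \<in> G r)" ..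
  then have s: "strict_mono s"
    and hit: "\<forall>j. \<exists>\<omega>. \<forall>i\<le>j. \<exists>r\<in>{s i..<s (Suc i)}. \<omega> \<in> G r" by simp_all
  from choice[OF hit]
  obtain \<omega> where \<omega>: "\<forall>j. \<forall>i\<le>j. \<exists>r\<in>{s i..<s (Suc i)}. \<omega> j \<in> G r" ..
  have free: "k_sum_free k (A (\<omega> j))" for j
    by (cases "\<omega> j") (simp add: A_def k_sum_free_rescaled S)
  obtain B where B: "k_sum_free k B"
    "\<And>W n. finite W \<Longrightarrow> \<exists>j\<ge>n. B \<inter> W = A (\<omega> j) \<inter> W"
    using ex_limit_set[where X = "\<lambda>j. A (\<omega> j)", OF free] by blast
  have "1 \<le> k" "1 / (real k + 1) < d" using assms(1) \<eta> by (simp_all add: d_def)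
  from k_sum_free_windows_eventually_sparse[OF B(1) this]
  obtain n where n: "\<forall>r>n. real (card (B \<inter> window r)) < d * real (card (window r))" ..
  define W where "W = (\<Union>r\<in>{s n..<s (Suc n)}. window (Suc r))"
  have "finite W" by (simp add: W_def)
  from B(2)[OF this, of n] obtain j where j: "j \<ge> n" "B \<inter> W = A (\<omega> j) \<inter> W" by blast
  obtain r where r: "r \<in> {s n..<s (Suc n)}" "\<omega> j \<in> G r" using \<omega>[rule_format, OF j(1)] by blast
  have "window (Suc r) \<subseteq> W" unfolding W_def using r(1) by (rule UN_upper)
  then have "B \<inter> window (Suc r) = A (\<omega> j) \<inter> window (Suc r)" using j(2) by blast
  then have "d * real (card (window (Suc r))) \<le> real (card (B \<inter> window (Suc r)))"
    using r(2) by (simp add: G_def)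
  moreover have "n < Suc r" using r(1) seq_suble[OF s, of n] by simp
  from n[rule_format, OF this]
  have "real (card (B \<inter> window (Suc r))) < d * real (card (window (Suc r)))" .
  ultimately show False by linarith
qed

end
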